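(* Let $p\in(1,2)$. There exist constants $c_p>0$ and $C_p<\infty$ depending only on $p$ such that the following holds for every even positive integer $n$. Let $X=(X_1,\ldots,X_n)$, where $X_1,\ldots,X_n$ are independent symmetric $p$-stable random variables with characteristic function $\mathbb{E}e^{isX_k}=\exp(-|s|^p)$, $s\in\mathbb{R}$. Then $$c_p\,n^{1/p}\le b_X(B_2^n)=\mathbb{E}|X|\le C_p\,n^{1/p},$$ while for every nonempty countable set $S\subset\mathbb{R}^n$ such that $B_2^n\subset\overline{\mathrm{conv}}(S\cup -S)$, $$M_X(S)\ge c_p\,n^{2/p-1/2}.$$ Consequently (since $2/p-1/2>1/p$), there is no constant $C$ such that for every even $n$ there exist $t_0\in\mathbb{R}^n$ and a nonempty countable $S\subset\mathbb{R}^n$ with $B_2^n-t_0\subset\overline{\mathrm{conv}}(S\cup -S)$ and $M_X(S)\le C\,b_X(B_2^n)$.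
   Context: For a random vector $X=(X_1,\ldots,X_n)$ and $t\in\mathbb{R}^n$ write $X_t=\langle t,X\rangle=\sum_i t_iX_i$; $|x|$ denotes the Euclidean norm of $x\in\mathbb{R}^n$. For a nonempty bounded set $T\subset\mathbb{R}^n$, $b_X(T):=\mathbb{E}\sup_{t\in T}X_t$. For a nonempty countable set $S\subset\mathbb{R}^n$, $$M_X(S):=\inf_{u>0}\Big[u+\sum_{t\in S}\mathbb{E}|X_t|\mathbf 1_{\{|X_t|\ge u\}}\Big]\in[0,\infty].$$ $B_2^n$ is the closed Euclidean unit ball in $\mathbb{R}^n$ and $\overline{\mathrm{conv}}$ denotes the closed convex hull. *)

theory Defs
  imports "HOL-Probability.Probability" "HOL-Library.Function_Algebras"
begin

text \<open>
  The dimension \<open>n\<close> is quantified inside the statement, so \<open>\<real>\<^sup>n\<close> is the library's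
  \<^const>\<open>Euclidean_space\<close>: functions \<open>nat \<Rightarrow> real\<close> that vanish at all indices \<open>\<ge> n\<close>, with the
  product topology. The coordinates are indexed by \<open>0, \<dots>, n - 1\<close>. The pointwise
  vector space structure below makes \<^const>\<open>convex\<close> and \<open>convex hull\<close> available there.
\<close>

instantiation "fun" :: (type, real_vector) real_vector
begin

definition scaleR_fun :: "real \<Rightarrow> ('a \<Rightarrow> 'b) \<Rightarrow> 'a \<Rightarrow> 'b" where
  "scaleR_fun r f = (\<lambda>x. r *\<^sub>R f x)"

instance
  by standard (simp_all add: scaleR_fun_def fun_eq_iff scaleR_add_right scaleR_add_left)

end

lemma scaleR_fun_apply [simp]:
  fixes f :: "'a \<Rightarrow> 'b::real_vector"
  shows "(r *\<^sub>R f) x = r *\<^sub>R f x"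
  by (simp add: scaleR_fun_def)

abbreviation Rn :: "nat \<Rightarrow> (nat \<Rightarrow> real) set" where
  "Rn n \<equiv> topspace (Euclidean_space n)"

definition unit_ball :: "nat \<Rightarrow> (nat \<Rightarrow> real) set" where
  "unit_ball n = {t \<in> Rn n. L2_set t {..<n} \<le> 1}"

definition closed_convex_hull :: "nat \<Rightarrow> (nat \<Rightarrow> real) set \<Rightarrow> (nat \<Rightarrow> real) set" where
  "closed_convex_hull n A = Euclidean_space n closure_of (convex hull A)"

definition lin_comb :: "nat \<Rightarrow> (nat \<Rightarrow> 'a \<Rightarrow> real) \<Rightarrow> (nat \<Rightarrow> real) \<Rightarrow> 'a \<Rightarrow> real" where
  "lin_comb n X t \<omega> = (\<Sum>i<n. t i * X i \<omega>)"

text \<open>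
  \<open>b_val\<close> is a Bochner integral, hence \<open>0\<close> by convention when the supremum is not integrable;
  a strictly positive lower bound on it therefore includes integrability.
\<close>

definition b_val :: "nat \<Rightarrow> 'a measure \<Rightarrow> (nat \<Rightarrow> 'a \<Rightarrow> real) \<Rightarrow> (nat \<Rightarrow> real) set \<Rightarrow> real" where
  "b_val n M X T = (\<integral>\<omega>. (SUP t\<in>T. lin_comb n X t \<omega>) \<partial>M)"

definition M_val :: "nat \<Rightarrow> 'a measure \<Rightarrow> (nat \<Rightarrow> 'a \<Rightarrow> real) \<Rightarrow> (nat \<Rightarrow> real) set \<Rightarrow> ennreal" where
  "M_val n M X S = (INF u\<in>{0<..}. ennreal u +
     (\<Sum>\<^sub>\<infinity>t\<in>S. \<integral>\<^sup>+\<omega>. ennreal (\<bar>lin_comb n X t \<omega>\<bar> *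
        indicator {\<omega>. \<bar>lin_comb n X t \<omega>\<bar> \<ge> u} \<omega>) \<partial>M))"

text \<open>
  The characteristic function determines the law, so it also says that the coordinates are
  symmetric and \<open>p\<close>-stable. \<open>indep_vars\<close> includes measurability.
\<close>

definition stable_vector :: "real \<Rightarrow> nat \<Rightarrow> 'a measure \<Rightarrow> (nat \<Rightarrow> 'a \<Rightarrow> real) \<Rightarrow> bool" where
  "stable_vector p n M X \<longleftrightarrow>
     prob_space M \<and> prob_space.indep_vars M (\<lambda>_. borel) X {..<n} \<and>
     (\<forall>k<n. \<forall>s. char (distr M borel (X k)) s = complex_of_real (exp (- (\<bar>s\<bar> powr p))))"

text \<open>
  The type argument names the type of the sample spaces. HOL cannot quantify over types below
  \<open>\<exists>c C\<close>; to keep the constants independent of the sample space, obtain them for the type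
  \<open>nat \<Rightarrow> real\<close>, on which every law of a random vector can be realised, and then show that they
  serve every other type as well.
\<close>

definition stable_bounds :: "'a itself \<Rightarrow> real \<Rightarrow> real \<Rightarrow> real \<Rightarrow> bool" where
  "stable_bounds _ p c C \<longleftrightarrow>
     (\<forall>n (M :: 'a measure) X. 0 < n \<and> even n \<and> stable_vector p n M X \<longrightarrow>
        c * real n powr (1 / p) \<le> b_val n M X (unit_ball n) \<and>
        b_val n M X (unit_ball n) = (\<integral>\<omega>. L2_set (\<lambda>i. X i \<omega>) {..<n} \<partial>M) \<and>
        b_val n M X (unit_ball n) \<le> C * real n powr (1 / p) \<and>
        (\<forall>S. S \<noteq> {} \<and> countable S \<and> S \<subseteq> Rn n \<and>
             unit_ball n \<subseteq> closed_convex_hull n (S \<union> uminus ` S) \<longrightarrow>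
             M_val n M X S \<ge> ennreal (c * real n powr (2 / p - 1 / 2))))"

end

theory Submission
  imports Defs
begin

text \<open>
  If \<open>g\<close> is a standard Gaussian variable independent of \<open>Y\<close>, then \<open>E exp (- s\<^sup>2 Y\<^sup>2 / 2)\<close> is the average of
  the characteristic function of \<open>Y\<close> at \<open>s g\<close>. For a \<open>p\<close>-stable \<open>Y\<close> of scale \<open>\<tau>\<close> this shows that
  \<open>E (1 - exp (- s\<^sup>2 Y\<^sup>2 / 2))\<close> has order \<open>(\<tau> s)\<^sup>p\<close>, which is all that is used about stable laws: it yields
  both bounds on the mean Euclidean norm and a lower bound of order \<open>\<tau>\<^sup>p r\<^bsup>1 - p\<^esup>\<close> on the truncated moments
  \<open>E \<bar>Y\<bar> 1{\<bar>Y\<bar> \<ge> r}\<close>.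

  If \<open>M_val\<close> is smaller than \<open>A\<close>, the truncated moments force \<open>\<Sum> \<bar>t\<bar>\<^sup>p\<close> over \<open>S\<close> to be at most a constant
  times \<open>A\<^sup>p\<close>. Hence at most \<open>n / 2\<close> points of \<open>S\<close> have length above \<open>const A n\<^bsup>-1/p\<^esup>\<close>. Choose \<open>n / 2\<close>
  orthonormal vectors orthogonal to those points. A random signed sum \<open>x\<close> of these vectors has length
  \<open>sqrt (n / 2)\<close>, and a sub-Gaussian union bound over the remaining, short points shows that for
  \<open>A \<le> const n\<^bsup>2/p - 1/2\<^esup>\<close> some choice of signs has \<open>\<bar>\<langle>t, x\<rangle>\<bar> < \<bar>x\<bar> / 2\<close> for every \<open>t\<close> in \<open>S\<close>. Then the
  halfspace defined by \<open>x\<close> separates a point of the unit ball from the closed convex hull.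
\<close>

section \<open>Gaussian averaging and stable laws\<close>

text \<open>The function \<open>exp (- x\<^sup>2 / 2)\<close> is the characteristic function of the
  standard Gaussian at \<open>x\<close>. Writing it as the Gaussian mean of
  \<open>iexp (x * g)\<close> and exchanging the two integrals leaves the characteristic function of
  \<open>Y\<close>. The integrand has modulus one, so Fubini applies.\<close>

lemma gaussian_average_char:
  fixes Y :: "'a \<Rightarrow> real" and s :: real
  assumes "prob_space M" and Y [measurable]: "Y \<in> borel_measurable M"
  shows "complex_of_real (\<integral>\<omega>. exp (- (s * Y \<omega>)\<^sup>2 / 2) \<partial>M) =
    (CLINT g|std_normal_distribution. char (distr M borel Y) (s * g))"
proof -
  interpret prob_space M by fact
  interpret N: real_distribution std_normal_distribution by (rule real_dist_normal_dist)
  interpret P: pair_prob_space M std_normal_distribution ..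
  have "complex_of_real (\<integral>\<omega>. exp (- (s * Y \<omega>)\<^sup>2 / 2) \<partial>M)
      = (CLINT \<omega>|M. char std_normal_distribution (s * Y \<omega>))"
    by (simp add: char_std_normal_distribution)
  also have "\<dots> = (CLINT \<omega>|M. (CLINT g|std_normal_distribution. iexp (s * Y \<omega> * g)))"
    by (simp add: char_def)
  also have "\<dots> = (CLINT g|std_normal_distribution. (CLINT \<omega>|M. iexp (s * Y \<omega> * g)))"
  proof (rule P.Fubini_integral[symmetric])
    show "integrable (M \<Otimes>\<^sub>M std_normal_distribution)
        (\<lambda>(\<omega>, g). iexp (s * Y \<omega> * g))"
      by (rule P.P.integrable_const_bound[where B = 1]) (auto simp: split_beta)
  qed
  also have "\<dots> = (CLINT g|std_normal_distribution. char (distr M borel Y) (s * g))"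
    by (simp add: char_def integral_distr ac_simps)
  finally show ?thesis .
qed

section \<open>Gaussian averages of \<open>1 - exp (- ((b * \<bar>g\<bar>) powr p))\<close>\<close>

lemma one_minus_exp_bounds:
  fixes y :: real
  assumes "0 \<le> y"
  shows "1 - exp (- y) \<le> y" "y \<le> 1 \<Longrightarrow> y / 2 \<le> 1 - exp (- y)"
proof -
  show "1 - exp (- y) \<le> y" using exp_ge_add_one_self[of "- y"] by simp
  assume "y \<le> 1"
  have "1 + y \<le> exp y" by simp
  then have "exp (- y) \<le> 1 / (1 + y)" using assms
    by (simp add: exp_minus divide_simps)
  also have "\<dots> \<le> 1 - y / 2"
  proof -
    have "y * y \<le> y * 1" using \<open>y \<le> 1\<close> assms by (intro mult_left_mono)
    then show ?thesis using assms by (simp add: field_simps)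
  qed
  finally show "y / 2 \<le> 1 - exp (- y)" by simp
qed

text \<open>Since 0 < p < 2, \<open>\<bar>g\<bar> powr p\<close> lies below
  \<open>1 + g\<^sup>2\<close>, whose Gaussian mean is 2.\<close>

lemma gaussian_powr_defect_le:
  fixes b p :: real
  assumes "0 \<le> b" "0 < p" "p < 2"
  shows "(\<integral>g. 1 - exp (- ((b * \<bar>g\<bar>) powr p)) \<partial>std_normal_distribution) \<le> 2 * b powr p"
proof -
  interpret N: real_distribution std_normal_distribution by (rule real_dist_normal_dist)
  have mom: "(\<integral>g. g^2 \<partial>std_normal_distribution) = 1" "integrable std_normal_distribution (\<lambda>g. g^2)"
    using std_normal_distribution_even_moments[of 1] by simp_all
  have "(\<integral>g. 1 - exp (- ((b * \<bar>g\<bar>) powr p)) \<partial>std_normal_distribution)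
      \<le> (\<integral>g. b powr p * (1 + g\<^sup>2) \<partial>std_normal_distribution)"
  proof (rule integral_mono)
    show "integrable std_normal_distribution (\<lambda>g. 1 - exp (- ((b * \<bar>g\<bar>) powr p)))"
      by (rule N.integrable_const_bound[where B = 1]) auto
    show "integrable std_normal_distribution (\<lambda>g. b powr p * (1 + g\<^sup>2))"
      using mom(2) by (intro integrable_mult_right integrable_add) auto
    fix g :: real
    have "\<bar>g\<bar> powr p \<le> 1 + g\<^sup>2"
    proof (cases "\<bar>g\<bar> \<le> 1")
      case True
      then have "\<bar>g\<bar> powr p \<le> 1" using assms by (intro powr_le1) auto
      then show ?thesis by (smt (verit) zero_le_power2)
    next
      case False
      then have "\<bar>g\<bar> powr p \<le> \<bar>g\<bar> powr 2" using assms by (intro powr_mono) auto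
      then show ?thesis using False by simp
    qed
    then have "(b * \<bar>g\<bar>) powr p \<le> b powr p * (1 + g\<^sup>2)"
      using assms by (simp add: powr_mult mult_left_mono)
    then show "1 - exp (- ((b * \<bar>g\<bar>) powr p)) \<le> b powr p * (1 + g\<^sup>2)"
      using one_minus_exp_bounds(1)[of "(b * \<bar>g\<bar>) powr p"] by simp
  qed
  also have "\<dots> = 2 * b powr p"
    using mom N.prob_space by (simp add: distrib_left)
  finally show ?thesis .
qed

text \<open>For \<open>b \<le> 1\<close> the number
  \<open>b powr p * min 1 (\<bar>g\<bar> powr p)\<close> lies in [0, 1], where
  \<open>1 - exp (- y)\<close> is at least \<open>y / 2\<close>. Replacing the minimum by a
  polynomial below it leaves the mean \<open>1/2 * (1/4 - 3/64) = 13/128\<close>, just above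
  1/10.\<close>

lemma gaussian_powr_defect_ge:
  fixes b p :: real
  assumes "0 \<le> b" "b \<le> 1" "0 < p" "p < 2"
  shows "b powr p / 10 \<le> (\<integral>g. 1 - exp (- ((b * \<bar>g\<bar>) powr p)) \<partial>std_normal_distribution)"
proof -
  interpret N: real_distribution std_normal_distribution by (rule real_dist_normal_dist)
  have mom: "(\<integral>g. g^2 \<partial>std_normal_distribution) = 1" "integrable std_normal_distribution (\<lambda>g. g^2)"
    "(\<integral>g. g^4 \<partial>std_normal_distribution) = 3" "integrable std_normal_distribution (\<lambda>g. g^4)"
    using std_normal_distribution_even_moments[of 1] std_normal_distribution_even_moments[of 2]
    by (simp_all add: fact_numeral)
  have bp: "b powr p \<le> 1" using assms by (intro powr_le1) auto
  have "b powr p / 10 \<le> (\<integral>g. b powr p / 2 * (g\<^sup>2 / 4 - g^4 / 64) \<partial>std_normal_distribution)"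
    using mom by simp
  also have "\<dots> \<le> (\<integral>g. 1 - exp (- ((b * \<bar>g\<bar>) powr p)) \<partial>std_normal_distribution)"
  proof (rule integral_mono)
    show "integrable std_normal_distribution (\<lambda>g. 1 - exp (- ((b * \<bar>g\<bar>) powr p)))"
      by (rule N.integrable_const_bound[where B = 1]) auto
    show "integrable std_normal_distribution (\<lambda>g. b powr p / 2 * (g\<^sup>2 / 4 - g^4 / 64))"
      using mom by (intro integrable_mult_right integrable_diff) auto
    fix g :: real
    define m where "m = min 1 (\<bar>g\<bar> powr p)"
    have m: "0 \<le> m" "m \<le> 1" by (auto simp: m_def)
    \<comment> \<open>a polynomial minorant with positive Gaussian mean \<open>1/4 - 3/64\<close>\<close>
    have "g\<^sup>2 / 4 - g^4 / 64 \<le> m"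
    proof (cases "\<bar>g\<bar> \<le> 1")
      case True
      then have "\<bar>g\<bar> powr 2 \<le> \<bar>g\<bar> powr p"
        using assms True powr_mono'[of p 2 "\<bar>g\<bar>"] by simp
      moreover have "\<bar>g\<bar> powr p \<le> 1" using True assms by (intro powr_le1) auto
      ultimately have "g\<^sup>2 \<le> m" by (auto simp: m_def)
      moreover have "0 \<le> g^2" "0 \<le> g ^ 4" by auto
      ultimately show ?thesis by linarith
    next
      case False
      then have "m = 1" using assms by (auto simp: m_def ge_one_powr_ge_zero)
      \<comment> \<open>Expanding the square gives exactly
        \<open>g\<^sup>2 / 4 - g^4 / 64 \<le> 1\<close>.\<close>
      moreover have "0 \<le> (g\<^sup>2 / 8 - 1)\<^sup>2" by simp
      ultimately show ?thesis by (simp add: power2_eq_square power4_eq_xxxx field_simps)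
    qed
    then have "b powr p / 2 * (g\<^sup>2 / 4 - g^4 / 64) \<le> b powr p / 2 * m"
      by (intro mult_left_mono) auto
    also have "\<dots> = (b powr p * m) / 2" by simp
    also have "\<dots> \<le> 1 - exp (- (b powr p * m))"
      using m bp by (intro one_minus_exp_bounds) (auto intro: mult_le_one)
    also have "\<dots> \<le> 1 - exp (- ((b * \<bar>g\<bar>) powr p))"
      using assms by (auto simp: powr_mult m_def intro!: mult_left_mono)
    finally show "b powr p / 2 * (g\<^sup>2 / 4 - g^4 / 64) \<le> 1 - exp (- ((b * \<bar>g\<bar>) powr p))" .
  qed
  finally show ?thesis .
qed

text \<open>The symmetric p-stable law of scale \<open>\<tau>\<close>, recorded through its
  characteristic function because Gaussian averaging uses nothing else. Scale 0 is the point mass at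
  0.\<close>

definition stable_law :: "real \<Rightarrow> real \<Rightarrow> 'a measure \<Rightarrow> ('a \<Rightarrow> real) \<Rightarrow> bool" where
  "stable_law p \<tau> M Y \<longleftrightarrow> prob_space M \<and> Y \<in> borel_measurable M \<and>
     (\<forall>s. char (distr M borel Y) s = complex_of_real (exp (- ((\<tau> * \<bar>s\<bar>) powr p))))"

lemma stable_law_gaussian_average:
  assumes "stable_law p \<tau> M Y" "0 \<le> \<tau>" "0 \<le> s"
  shows "(\<integral>\<omega>. 1 - exp (- (s * Y \<omega>)\<^sup>2 / 2) \<partial>M) =
    (\<integral>g. 1 - exp (- ((\<tau> * s * \<bar>g\<bar>) powr p)) \<partial>std_normal_distribution)"
proof -
  interpret prob_space M using assms by (simp add: stable_law_def)
  interpret N: real_distribution std_normal_distribution by (rule real_dist_normal_dist)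
  have Y [measurable]: "Y \<in> borel_measurable M" using assms by (simp add: stable_law_def)
  have "complex_of_real (\<integral>\<omega>. exp (- (s * Y \<omega>)\<^sup>2 / 2) \<partial>M) =
      (CLINT g|std_normal_distribution. complex_of_real (exp (- ((\<tau> * \<bar>s * g\<bar>) powr p))))"
    using assms gaussian_average_char[OF prob_space_axioms Y] by (simp add: stable_law_def)
  also have "\<dots> = complex_of_real (\<integral>g. exp (- ((\<tau> * s * \<bar>g\<bar>) powr p)) \<partial>std_normal_distribution)"
    using assms by (simp add: abs_mult mult.assoc)
  finally have eq: "(\<integral>\<omega>. exp (- (s * Y \<omega>)\<^sup>2 / 2) \<partial>M) =
      (\<integral>g. exp (- ((\<tau> * s * \<bar>g\<bar>) powr p)) \<partial>std_normal_distribution)"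
    by (simp only: of_real_eq_iff)
  have "integrable M (\<lambda>\<omega>. exp (- (s * Y \<omega>)\<^sup>2 / 2))"
    by (rule integrable_const_bound[where B = 1]) auto
  moreover have "integrable std_normal_distribution (\<lambda>g. exp (- ((\<tau> * s * \<bar>g\<bar>) powr p)))"
    by (rule N.integrable_const_bound[where B = 1]) auto
  ultimately show ?thesis
    using eq prob_space N.prob_space by simp
qed

lemma stable_law_defect_bounds:
  assumes "stable_law p \<tau> M Y" "0 \<le> \<tau>" "0 \<le> s" "0 < p" "p < 2"
  shows "(\<integral>\<omega>. 1 - exp (- (s * Y \<omega>)\<^sup>2 / 2) \<partial>M) \<le> 2 * (\<tau> * s) powr p"
    and "\<tau> * s \<le> 1 \<Longrightarrow> (\<tau> * s) powr p / 10 \<le> (\<integral>\<omega>. 1 - exp (- (s * Y \<omega>)\<^sup>2 / 2) \<partial>M)"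
  using assms gaussian_powr_defect_le[of "\<tau> * s" p] gaussian_powr_defect_ge[of "\<tau> * s" p]
  unfolding stable_law_gaussian_average[OF assms(1-3)] by auto

text \<open>With \<open>L = tail_scale p\<close> one has \<open>L\<^bsup>-p\<^esup> / 10 = 8 / L\<^sup>2\<close>, twice the term subtracted in the next proof.\<close>

definition tail_scale :: "real \<Rightarrow> real" where
  "tail_scale p = 80 powr (1 / (2 - p))"

lemma tail_scale_ge: "1 < p \<Longrightarrow> p < 2 \<Longrightarrow> 80 \<le> tail_scale p"
  unfolding tail_scale_def using powr_mono[of 1 "1 / (2 - p)" 80] by simp

text \<open>With \<open>L = tail_scale p\<close>, passing from scale \<open>1 / r\<close> to
  \<open>1 / (L * r)\<close> costs the mean of \<open>1 - exp (- (s * Y)\<^sup>2 / 2)\<close> a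
  factor of order \<open>L powr (-p)\<close>, but it costs the part coming from
  \<open>\<bar>Y\<bar> < r\<close> a factor of order \<open>L powr (-2)\<close>. Since p < 2, for
  large L the values with \<open>\<bar>Y\<bar> \<ge> r\<close> must supply the rest.\<close>

lemma stable_law_tail_moment:
  assumes "stable_law p \<tau> M Y" "0 < \<tau>" "\<tau> \<le> r" "1 < p" "p < 2"
  shows "ennreal (4 / tail_scale p * \<tau> powr p * r powr (1 - p)) \<le>
    (\<integral>\<^sup>+\<omega>. ennreal (\<bar>Y \<omega>\<bar> * indicator {\<omega>. \<bar>Y \<omega>\<bar> \<ge> r} \<omega>) \<partial>M)"
proof -
  interpret prob_space M using assms by (simp add: stable_law_def)
  have Y [measurable]: "Y \<in> borel_measurable M" using assms by (simp add: stable_law_def)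
  define L where "L = tail_scale p"
  have L: "80 \<le> L" using assms tail_scale_ge by (simp add: L_def)
  have r: "0 < r" using assms by simp
  define h where "h s \<omega> = 1 - exp (- (s * Y \<omega>)\<^sup>2 / 2)" for s \<omega>
  have h_int: "integrable M (h s)" for s
    unfolding h_def by (rule integrable_const_bound[where B = 1]) auto
  \<comment> \<open>For \<open>\<bar>Y\<bar> < r\<close> both terms are quadratic in \<open>Y\<close> and the difference is nonpositive; for \<open>\<bar>Y\<bar> \<ge> r\<close> it is
    at most \<open>\<bar>Y\<bar> / (L r)\<close>.\<close>
  define f where "f \<omega> = L * r * (h (1 / (L * r)) \<omega> - 2 / L\<^sup>2 * h (1 / r) \<omega>)" for \<omega>
  have f_int: "integrable M f" unfolding f_def using h_int by auto
  have pw: "f \<omega> \<le> \<bar>Y \<omega>\<bar> * indicator {\<omega>. \<bar>Y \<omega>\<bar> \<ge> r} \<omega>" for \<omega>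
  proof -
    define z where "z = \<bar>Y \<omega>\<bar> / r"
    have z: "0 \<le> z" using r by (simp add: z_def)
    have h1: "h (1 / (L * r)) \<omega> = 1 - exp (- (z\<^sup>2 / L\<^sup>2 / 2))"
      unfolding h_def z_def using r L by (simp add: power_mult_distrib power_divide)
    have h2: "h (1 / r) \<omega> = 1 - exp (- (z\<^sup>2 / 2))"
      unfolding h_def z_def using r L by (simp add: power_mult_distrib power_divide)
    have h1le: "h (1 / (L * r)) \<omega> \<le> z\<^sup>2 / L\<^sup>2 / 2"
      unfolding h1 by (rule one_minus_exp_bounds) auto
    show ?thesis
    proof (cases "\<bar>Y \<omega>\<bar> \<ge> r")
      case True
      have half: "w / 2 \<le> w" if "0 \<le> w" for w :: real using that by simp
      have "h (1 / (L * r)) \<omega> \<le> z / L"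
      proof (cases "z / L \<le> 1")
        case True
        have "z\<^sup>2 / L\<^sup>2 / 2 = (z / L) * (z / L) / 2" by (simp add: power2_eq_square)
        also have "\<dots> \<le> (z / L) * (z / L)" by (rule half) simp
        also have "\<dots> \<le> z / L * 1" using True z L by (intro mult_left_mono) auto
        finally show ?thesis using h1le by simp
      next
        case False
        then show ?thesis unfolding h1 by (smt (verit) exp_gt_zero)
      qed
      moreover have "0 \<le> 2 / L\<^sup>2 * h (1 / r) \<omega>" unfolding h2 by simp
      ultimately have "f \<omega> \<le> L * r * (z / L)"
        unfolding f_def using L r by (intro mult_left_mono) auto
      also have "\<dots> = \<bar>Y \<omega>\<bar>" using L r by (simp add: z_def)
      finally show ?thesis using True by simp
    next
      case False
      then have "z \<le> 1" using r by (simp add: z_def)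
      then have "z\<^sup>2 / 2 \<le> 1" using z power_le_one[of z 2] by simp
      then have "z\<^sup>2 / 2 / 2 \<le> h (1 / r) \<omega>"
        unfolding h2 by (intro one_minus_exp_bounds) auto
      then have "2 / L\<^sup>2 * (z\<^sup>2 / 2 / 2) \<le> 2 / L\<^sup>2 * h (1 / r) \<omega>"
        by (intro mult_left_mono) auto
      then have "h (1 / (L * r)) \<omega> - 2 / L\<^sup>2 * h (1 / r) \<omega> \<le> 0" using h1le by simp
      then have "f \<omega> \<le> 0" unfolding f_def using L r by (intro mult_nonneg_nonpos) auto
      then show ?thesis using False by simp
    qed
  qed
  \<comment> \<open>Where \<open>\<bar>Y\<bar> < r\<close> the function \<open>f\<close> is
    nonpositive, so its positive part obeys the same pointwise bound and turns into a nonnegative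
    integral.\<close>
  have g_int: "integrable M (\<lambda>\<omega>. max 0 (f \<omega>))" using f_int by simp
  have "4 / L * \<tau> powr p * r powr (1 - p)
      = L * r * ((\<tau> * (1 / (L * r))) powr p / 10 - 2 / L\<^sup>2 * (2 * (\<tau> * (1 / r)) powr p))"
  proof -
    have "L powr (2 - p) = 80" using assms by (simp add: L_def tail_scale_def powr_powr)
    then have Lp: "L powr p = L\<^sup>2 / 80" using L by (simp add: powr_diff field_simps)
    show ?thesis using L r assms unfolding powr_mult powr_divide
      by (simp add: Lp powr_diff powr_mult powr_divide field_simps power2_eq_square)
  qed
  also have "\<dots> \<le> L * r * ((\<integral>\<omega>. h (1 / (L * r)) \<omega> \<partial>M) - 2 / L\<^sup>2 * (\<integral>\<omega>. h (1 / r) \<omega> \<partial>M))"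
  proof -
    have "\<tau> * (1 / (L * r)) \<le> 1"
    proof -
      have "1 * r \<le> L * r" using L r by (intro mult_right_mono) auto
      with assms have "\<tau> \<le> L * r" by linarith
      then show ?thesis using L r by (simp add: divide_simps)
    qed
    then have "(\<tau> * (1 / (L * r))) powr p / 10 \<le> (\<integral>\<omega>. h (1 / (L * r)) \<omega> \<partial>M)"
      unfolding h_def using assms L r by (intro stable_law_defect_bounds(2)[OF assms(1)]) auto
    moreover have "(\<integral>\<omega>. h (1 / r) \<omega> \<partial>M) \<le> 2 * (\<tau> * (1 / r)) powr p"
      unfolding h_def using assms L r by (intro stable_law_defect_bounds(1)[OF assms(1)]) auto
    ultimately show ?thesis using L r
      by (intro mult_left_mono diff_mono) auto
  qed
  also have "\<dots> = (\<integral>\<omega>. f \<omega> \<partial>M)"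
    unfolding f_def using h_int by simp
  also have "\<dots> \<le> (\<integral>\<omega>. max 0 (f \<omega>) \<partial>M)"
    using f_int g_int by (intro integral_mono) auto
  finally have "ennreal (4 / L * \<tau> powr p * r powr (1 - p)) \<le> ennreal (\<integral>\<omega>. max 0 (f \<omega>) \<partial>M)"
    by (rule ennreal_leI)
  also have "\<dots> = (\<integral>\<^sup>+\<omega>. ennreal (max 0 (f \<omega>)) \<partial>M)"
    using g_int by (intro nn_integral_eq_integral[symmetric]) auto
  also have "\<dots> \<le> (\<integral>\<^sup>+\<omega>. ennreal (\<bar>Y \<omega>\<bar> * indicator {\<omega>. \<bar>Y \<omega>\<bar> \<ge> r} \<omega>) \<partial>M)"
    using pw by (intro nn_integral_mono ennreal_leI) (simp add: max_def)
  finally show ?thesis by (simp add: L_def)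
qed

section \<open>Linear combinations of the coordinates and their tail sums\<close>

lemma stable_vectorD:
  assumes "stable_vector p n M X"
  shows "prob_space M" "prob_space.indep_vars M (\<lambda>_. borel) X {..<n}"
    "\<And>k. k < n \<Longrightarrow> X k \<in> borel_measurable M"
    "\<And>k s. k < n \<Longrightarrow> char (distr M borel (X k)) s = complex_of_real (exp (- (\<bar>s\<bar> powr p)))"
proof -
  show 1: "prob_space M" and 2: "prob_space.indep_vars M (\<lambda>_. borel) X {..<n}"
    using assms by (auto simp: stable_vector_def)
  show "X k \<in> borel_measurable M" if "k < n" for k
    using 2 that by (simp add: prob_space.indep_vars_def2[OF 1])
  show "char (distr M borel (X k)) s = complex_of_real (exp (- (\<bar>s\<bar> powr p)))" if "k < n" for k s
    using assms that by (auto simp: stable_vector_def)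
qed

lemma stable_vector_coordinate:
  assumes "stable_vector p n M X" "k < n"
  shows "stable_law p 1 M (X k)"
  using stable_vectorD[OF assms(1)] assms(2) by (simp add: stable_law_def)

lemma lin_comb_measurable:
  assumes "stable_vector p n M X"
  shows "lin_comb n X t \<in> borel_measurable M"
  using stable_vectorD(3)[OF assms] unfolding lin_comb_def
  by (intro borel_measurable_sum borel_measurable_times) auto

text \<open>Independence makes the characteristic function a product, and the exponents
  \<open>\<bar>t i * s\<bar> powr p\<close> add. The scale is therefore the l^p length of
  \<open>t\<close>.\<close>

lemma stable_vector_lin_comb:
  assumes sv: "stable_vector p n M X" and p: "0 < p"
  shows "stable_law p ((\<Sum>i<n. \<bar>t i\<bar> powr p) powr (1 / p)) M (lin_comb n X t)"
proof -
  interpret prob_space M using stable_vectorD[OF sv] by simp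
  note X = stable_vectorD(3)[OF sv]
  have "char (distr M borel (lin_comb n X t)) s =
      complex_of_real (exp (- (((\<Sum>i<n. \<bar>t i\<bar> powr p) powr (1 / p) * \<bar>s\<bar>) powr p)))" for s
  proof -
    have ind: "indep_vars (\<lambda>_. borel) (\<lambda>i \<omega>. t i * X i \<omega>) {..<n}"
      by (rule indep_vars_compose2[OF stable_vectorD(2)[OF sv]]) auto
    have one: "char (distr M borel (\<lambda>\<omega>. t i * X i \<omega>)) s = complex_of_real (exp (- (\<bar>t i * s\<bar> powr p)))"
      if "i < n" for i
    proof -
      have "char (distr M borel (\<lambda>\<omega>. t i * X i \<omega>)) s = char (distr M borel (X i)) (t i * s)"
        unfolding char_def using X[OF that] by (simp add: integral_distr ac_simps)
      then show ?thesis by (simp only: stable_vectorD(4)[OF sv that])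
    qed
    have "char (distr M borel (lin_comb n X t)) s
        = (\<Prod>i<n. char (distr M borel (\<lambda>\<omega>. t i * X i \<omega>)) s)"
      unfolding lin_comb_def by (rule char_distr_sum[OF ind])
    also have "\<dots> = (\<Prod>i<n. complex_of_real (exp (- (\<bar>t i * s\<bar> powr p))))"
      by (intro prod.cong refl one) simp
    also have "\<dots> = complex_of_real (exp (- (\<Sum>i<n. \<bar>t i * s\<bar> powr p)))"
      by (simp add: exp_sum sum_negf[symmetric])
    also have "(\<Sum>i<n. \<bar>t i * s\<bar> powr p) = ((\<Sum>i<n. \<bar>t i\<bar> powr p) powr (1 / p) * \<bar>s\<bar>) powr p"
      using p by (simp add: abs_mult powr_mult powr_powr sum_nonneg sum_distrib_right)
    finally show ?thesis .
  qed
  then show ?thesis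
    using lin_comb_measurable[OF sv] prob_space_axioms by (simp add: stable_law_def)
qed

text \<open>After scaling to Euclidean length one every coordinate is at most 1 in absolute value,
  and lowering the exponent from 2 to p only enlarges the powers. This lets Euclidean lengths
  replace the l^p scales.\<close>

lemma L2_set_powr_le_sum_powr:
  fixes t :: "'i \<Rightarrow> real"
  assumes "finite I" "0 < p" "p \<le> 2"
  shows "L2_set t I powr p \<le> (\<Sum>i\<in>I. \<bar>t i\<bar> powr p)"
proof (cases "L2_set t I = 0")
  case False
  define a where "a = L2_set t I"
  have a: "0 < a" using False unfolding a_def by (simp add: less_le)
  have le: "\<bar>t i\<bar> \<le> a" if "i \<in> I" for i
    unfolding a_def L2_set_def real_sqrt_abs[symmetric]
    by (rule real_sqrt_le_mono) (use that assms in \<open>auto intro: member_le_sum\<close>)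
  have "1 = (\<Sum>i\<in>I. (\<bar>t i\<bar> / a)\<^sup>2)"
    using a by (simp add: power_divide a_def L2_set_def sum_nonneg flip: sum_divide_distrib)
  also have "\<dots> \<le> (\<Sum>i\<in>I. (\<bar>t i\<bar> / a) powr p)"
  proof (rule sum_mono)
    fix i assume "i \<in> I"
    then have "\<bar>t i\<bar> / a \<le> 1" using le a by simp
    then show "(\<bar>t i\<bar> / a)\<^sup>2 \<le> (\<bar>t i\<bar> / a) powr p"
      using powr_mono'[of p 2 "\<bar>t i\<bar> / a"] a assms by simp
  qed
  also have "\<dots> = (\<Sum>i\<in>I. \<bar>t i\<bar> powr p) / a powr p"
    using a by (simp add: powr_divide sum_divide_distrib)
  finally show ?thesis using a by (simp add: a_def[symmetric])
qed (auto intro: sum_nonneg)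

text \<open>For \<open>0 < \<tau> \<le> A\<close> this is the tail moment bound at level
  \<open>A\<close>. For \<open>\<tau> > A\<close> the same bound at level \<open>\<tau>\<close>
  yields a moment of at least \<open>\<kappa> * \<tau>\<close>; the assumed bound then forces
  \<open>\<kappa> * \<tau> \<le> A\<close>, and the negative exponent \<open>1 - p\<close> turns
  this into the claim. The factor \<open>\<kappa> powr p\<close>, with
  \<open>\<kappa> \<le> 1\<close>, fits both cases.\<close>

lemma stable_law_truncated_moment:
  assumes Y: "stable_law p \<tau> M Y" "0 \<le> \<tau>" and p: "1 < p" "p < 2" and A: "0 < A"
    and le: "(\<integral>\<^sup>+\<omega>. ennreal (\<bar>Y \<omega>\<bar> * indicator {\<omega>. \<bar>Y \<omega>\<bar> \<ge> A} \<omega>) \<partial>M) \<le> ennreal A"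
  shows "ennreal ((4 / tail_scale p) powr p * \<tau> powr p * A powr (1 - p)) \<le>
    (\<integral>\<^sup>+\<omega>. ennreal (\<bar>Y \<omega>\<bar> * indicator {\<omega>. \<bar>Y \<omega>\<bar> \<ge> A} \<omega>) \<partial>M)" (is "_ \<le> ?I")
proof -
  define \<kappa> where "\<kappa> = 4 / tail_scale p"
  have \<kappa>: "0 < \<kappa>" "\<kappa> \<le> 1" using tail_scale_ge[OF p] by (auto simp: \<kappa>_def)
  consider "\<tau> = 0" | "0 < \<tau>" "\<tau> \<le> A" | "A < \<tau>" using Y by linarith
  then have "ennreal (\<kappa> powr p * \<tau> powr p * A powr (1 - p)) \<le> ?I"
  proof cases
    case 1
    then show ?thesis by simp
  next
    case 2
    have "\<kappa> powr p \<le> \<kappa> powr 1" using \<kappa> p by (intro powr_mono') auto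
    then have "\<kappa> powr p * \<tau> powr p * A powr (1 - p) \<le> \<kappa> * \<tau> powr p * A powr (1 - p)"
      using \<kappa> by (intro mult_right_mono) auto
    then show ?thesis
      by (rule order_trans[OF ennreal_leI stable_law_tail_moment[OF Y(1) 2 p, folded \<kappa>_def]])
  next
    case 3
    then have \<tau>: "0 < \<tau>" using A by simp
    have "\<kappa> * \<tau> = \<kappa> * \<tau> powr p * \<tau> powr (1 - p)"
      using \<tau> by (simp add: mult.assoc flip: powr_add)
    then have "ennreal (\<kappa> * \<tau>) \<le> (\<integral>\<^sup>+\<omega>. ennreal (\<bar>Y \<omega>\<bar> * indicator {\<omega>. \<bar>Y \<omega>\<bar> \<ge> \<tau>} \<omega>) \<partial>M)"
      using stable_law_tail_moment[OF Y(1) \<tau> order_refl p] unfolding \<kappa>_def[symmetric]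
      by (simp only:)
    also have "\<dots> \<le> ?I"
      using 3 by (intro nn_integral_mono ennreal_leI mult_left_mono) (auto split: split_indicator)
    finally have I: "ennreal (\<kappa> * \<tau>) \<le> ?I" .
    have "ennreal (\<kappa> * \<tau>) \<le> ennreal A" by (rule order_trans[OF I le])
    then have "\<kappa> * \<tau> \<le> A" using A by simp
    then have "A powr (1 - p) \<le> (\<kappa> * \<tau>) powr (1 - p)"
      using \<kappa> \<tau> p by (intro powr_mono2') auto
    then have "\<kappa> powr p * \<tau> powr p * A powr (1 - p) \<le> (\<kappa> * \<tau>) powr p * (\<kappa> * \<tau>) powr (1 - p)"
      using \<kappa> \<tau> by (simp add: powr_mult mult_left_mono)
    also have "\<dots> = \<kappa> * \<tau>" using \<kappa> \<tau> by (simp flip: powr_add)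
    finally show ?thesis by (rule order_trans[OF ennreal_leI I])
  qed
  then show ?thesis by (simp add: \<kappa>_def)
qed

text \<open>Every \<open>t\<close> contributes at least
  \<open>\<kappa> powr p * L2_set t {..<n} powr p * A powr (1 - p)\<close> to a sum that is at most
  \<open>A\<close>. Dividing gives the claim, with
  \<open>1 / \<kappa> = tail_scale p / 4\<close>.\<close>

lemma sum_L2_powr_le_of_tail_sum:
  assumes sv: "stable_vector p n M X" and p: "1 < p" "p < 2" and u: "0 < u"
    and A: "ennreal u + (\<Sum>\<^sub>\<infinity>t\<in>S. \<integral>\<^sup>+\<omega>. ennreal (\<bar>lin_comb n X t \<omega>\<bar> *
        indicator {\<omega>. \<bar>lin_comb n X t \<omega>\<bar> \<ge> u} \<omega>) \<partial>M) \<le> ennreal A"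
    and G: "finite G" "G \<subseteq> S"
  shows "(\<Sum>t\<in>G. L2_set t {..<n} powr p) \<le> (tail_scale p / 4 * A) powr p"
proof -
  define J where "J v t = (\<integral>\<^sup>+\<omega>. ennreal (\<bar>lin_comb n X t \<omega>\<bar> *
        indicator {\<omega>. \<bar>lin_comb n X t \<omega>\<bar> \<ge> v} \<omega>) \<partial>M)" for v t
  define \<tau> where "\<tau> t = (\<Sum>i<n. \<bar>t i\<bar> powr p) powr (1 / p)" for t :: "nat \<Rightarrow> real"
  define \<kappa> where "\<kappa> = 4 / tail_scale p"
  have \<kappa>: "0 < \<kappa>" using tail_scale_ge[OF p] by (auto simp: \<kappa>_def)
  note A = A[folded J_def]
  have "ennreal u \<le> ennreal u + (\<Sum>\<^sub>\<infinity>t\<in>S. J u t)" by simp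
  also note A
  finally have "ennreal u \<le> ennreal A" .
  then have uA: "u \<le> A" and A0: "0 < A" using u by (auto simp: ennreal_le_iff2)
  \<comment> \<open>Raising the truncation level from \<open>u\<close> to \<open>A\<close> makes the level equal to the bound on the sum.\<close>
  have "(\<Sum>t\<in>G. J A t) \<le> (\<Sum>t\<in>G. J u t)"
    unfolding J_def using uA
    by (intro sum_mono nn_integral_mono ennreal_leI mult_left_mono) (auto split: split_indicator)
  \<comment> \<open>Over \<open>ennreal\<close> the infinite sum is the supremum of its finite
    partial sums.\<close>
  also have "\<dots> \<le> (\<Sum>\<^sub>\<infinity>t\<in>S. J u t)"
    using G by (subst nonneg_infsum_complete) (auto intro: SUP_upper)
  also have "\<dots> \<le> ennreal u + (\<Sum>\<^sub>\<infinity>t\<in>S. J u t)" by (simp add: add_increasing)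
  also note A
  finally have sum: "(\<Sum>t\<in>G. J A t) \<le> ennreal A" .
  have J_ge: "ennreal (\<kappa> powr p * L2_set t {..<n} powr p * A powr (1 - p)) \<le> J A t" if "t \<in> G" for t
  proof -
    have "J A t \<le> (\<Sum>t\<in>G. J A t)" using G that by (intro member_le_sum) auto
    then have "J A t \<le> ennreal A" using sum by (rule order_trans)
    then have "ennreal (\<kappa> powr p * \<tau> t powr p * A powr (1 - p)) \<le> J A t"
      unfolding J_def \<kappa>_def \<tau>_def using p A0
      by (intro stable_law_truncated_moment stable_vector_lin_comb[OF sv]) auto
    moreover have "L2_set t {..<n} powr p \<le> \<tau> t powr p"
      using L2_set_powr_le_sum_powr[of "{..<n}" p t] p
      by (simp add: \<tau>_def powr_powr sum_nonneg)
    then have "\<kappa> powr p * L2_set t {..<n} powr p * A powr (1 - p) \<le> \<kappa> powr p * \<tau> t powr p * A powr (1 - p)"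
      by (intro mult_right_mono mult_left_mono) auto
    ultimately show ?thesis by (rule order_trans[OF ennreal_leI, rotated])
  qed
  have "(\<Sum>t\<in>G. ennreal (\<kappa> powr p * L2_set t {..<n} powr p * A powr (1 - p))) \<le> ennreal A"
    by (rule order_trans[OF sum_mono[OF J_ge] sum])
  then have "(\<Sum>t\<in>G. \<kappa> powr p * L2_set t {..<n} powr p * A powr (1 - p)) \<le> A"
    using A0 by simp
  then have "\<kappa> powr p * A powr (1 - p) * (\<Sum>t\<in>G. L2_set t {..<n} powr p) \<le> A"
    by (simp add: sum_distrib_left mult_ac)
  then have "(\<Sum>t\<in>G. L2_set t {..<n} powr p) \<le> A / (\<kappa> powr p * A powr (1 - p))"
    using \<kappa> A0 by (simp add: field_simps)
  also have "\<dots> = (tail_scale p / 4 * A) powr p"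
    using \<kappa> A0 tail_scale_ge[OF p]
    by (simp add: \<kappa>_def powr_mult powr_divide powr_diff field_simps)
  finally show ?thesis .
qed

section \<open>The mean Euclidean norm\<close>

lemma SUP_lin_comb_unit_ball:
  "(SUP t\<in>unit_ball n. lin_comb n X t \<omega>) = L2_set (\<lambda>i. X i \<omega>) {..<n}"
proof (rule cSup_eq_maximum)
  define r where "r = L2_set (\<lambda>i. X i \<omega>) {..<n}"
  have r: "0 \<le> r" by (simp add: r_def)
  \<comment> \<open>The maximiser is the normalised sample vector. If \<open>r = 0\<close>, division
    by zero makes \<open>t\<close> the zero vector, which lies in the ball and attains the value
    0.\<close>
  define t where "t i = (if i < n then X i \<omega> / r else 0)" for i
  have "L2_set t {..<n} = L2_set (\<lambda>i. X i \<omega> * (1 / r)) {..<n}"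
    by (intro L2_set_cong) (auto simp: t_def)
  also have "\<dots> = r / r" using L2_set_left_distrib[of "1 / r" "\<lambda>i. X i \<omega>" "{..<n}"] r by (simp add: r_def)
  finally have "t \<in> unit_ball n" by (auto simp: unit_ball_def topspace_Euclidean_space t_def)
  moreover have "lin_comb n X t \<omega> = r"
  proof -
    have "lin_comb n X t \<omega> = (\<Sum>i<n. (X i \<omega>)\<^sup>2) / r"
      by (simp add: lin_comb_def t_def power2_eq_square sum_divide_distrib)
    also have "\<dots> = r\<^sup>2 / r" by (simp add: r_def L2_set_def sum_nonneg)
    finally show ?thesis by (simp add: power2_eq_square)
  qed
  ultimately show "L2_set (\<lambda>i. X i \<omega>) {..<n} \<in> (\<lambda>t. lin_comb n X t \<omega>) ` unit_ball n"
    by (force simp: r_def)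
  fix y assume "y \<in> (\<lambda>t. lin_comb n X t \<omega>) ` unit_ball n"
  then obtain s where s: "L2_set s {..<n} \<le> 1" "y = lin_comb n X s \<omega>" by (auto simp: unit_ball_def)
  have "y \<le> (\<Sum>i<n. \<bar>s i\<bar> * \<bar>X i \<omega>\<bar>)"
    unfolding s lin_comb_def by (intro sum_mono) (simp flip: abs_mult)
  also have "\<dots> \<le> L2_set s {..<n} * r" unfolding r_def by (rule L2_set_mult_ineq)
  also have "\<dots> \<le> 1 * r" using s r by (intro mult_right_mono)
  finally show "y \<le> L2_set (\<lambda>i. X i \<omega>) {..<n}" by (simp add: r_def)
qed

lemma b_val_unit_ball: "b_val n M X (unit_ball n) = (\<integral>\<omega>. L2_set (\<lambda>i. X i \<omega>) {..<n} \<partial>M)"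
  by (simp add: b_val_def SUP_lin_comb_unit_ball)

lemma L2_set_measurable:
  assumes "stable_vector p n M X"
  shows "(\<lambda>\<omega>. L2_set (\<lambda>i. X i \<omega>) {..<n}) \<in> borel_measurable M"
  unfolding L2_set_def using stable_vectorD(3)[OF assms]
  by (intro measurable_compose[OF _ borel_measurable_sqrt] borel_measurable_sum borel_measurable_power) auto

section \<open>Two-sided bounds for the mean of \<open>1 - exp (- (s * N)\<^sup>2 / 2)\<close>,
  where N is the Euclidean norm\<close>

lemma one_minus_prod_le_sum:
  fixes f :: "'i \<Rightarrow> real"
  assumes "finite I" "\<And>i. i \<in> I \<Longrightarrow> 0 \<le> f i \<and> f i \<le> 1"
  shows "1 - (\<Prod>i\<in>I. f i) \<le> (\<Sum>i\<in>I. 1 - f i)"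
  using assms
proof (induction I rule: finite_induct)
  case (insert i I)
  have P: "0 \<le> (\<Prod>i\<in>I. f i)" "(\<Prod>i\<in>I. f i) \<le> 1"
    using insert by (auto intro: prod_nonneg prod_le_1)
  have "1 - f i * (\<Prod>i\<in>I. f i) = (1 - f i) * (\<Prod>i\<in>I. f i) + (1 - (\<Prod>i\<in>I. f i))"
    by (simp add: algebra_simps)
  also have "\<dots> \<le> (1 - f i) * 1 + (1 - (\<Prod>i\<in>I. f i))"
    using insert P by (intro add_right_mono mult_left_mono) auto
  finally show ?case using insert by simp
qed simp

lemma exp_L2_set_eq_prod:
  fixes f :: "nat \<Rightarrow> real"
  shows "exp (- (s * L2_set f {..<n})\<^sup>2 / 2) = (\<Prod>i<n. exp (- (s * f i)\<^sup>2 / 2))"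
proof -
  have "- (s * L2_set f {..<n})\<^sup>2 / 2 = (\<Sum>i<n. - (s * f i)\<^sup>2 / 2)"
    by (simp add: L2_set_def power_mult_distrib sum_nonneg sum_distrib_left sum_divide_distrib sum_negf)
  then show ?thesis by (simp only: exp_sum finite_lessThan)
qed

text \<open>The exponential factors over the coordinates, so its distance from 1 is at most the sum
  of the coordinate distances, each of mean at most \<open>2 * s powr p\<close>.\<close>

lemma norm_defect_le:
  assumes sv: "stable_vector p n M X" and p: "0 < p" "p < 2" and s: "0 \<le> s"
  shows "(\<integral>\<omega>. 1 - exp (- (s * L2_set (\<lambda>i. X i \<omega>) {..<n})\<^sup>2 / 2) \<partial>M) \<le> 2 * real n * s powr p"
proof -
  interpret prob_space M using stable_vectorD[OF sv] by simp
  note X [measurable] = stable_vectorD(3)[OF sv]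
  note L2_set_measurable[OF sv, measurable]
  have int: "integrable M (\<lambda>\<omega>. 1 - exp (- (s * X i \<omega>)\<^sup>2 / 2))" if "i < n" for i
    using X[OF that] by (intro integrable_const_bound[where B = 1]) auto
  have "(\<integral>\<omega>. 1 - exp (- (s * L2_set (\<lambda>i. X i \<omega>) {..<n})\<^sup>2 / 2) \<partial>M)
      \<le> (\<integral>\<omega>. (\<Sum>i<n. 1 - exp (- (s * X i \<omega>)\<^sup>2 / 2)) \<partial>M)"
  proof (rule integral_mono)
    show "integrable M (\<lambda>\<omega>. 1 - exp (- (s * L2_set (\<lambda>i. X i \<omega>) {..<n})\<^sup>2 / 2))"
      by (intro integrable_const_bound[where B = 1]) auto
    show "integrable M (\<lambda>\<omega>. \<Sum>i<n. 1 - exp (- (s * X i \<omega>)\<^sup>2 / 2))"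
      using int by (intro Bochner_Integration.integrable_sum) auto
    show "1 - exp (- (s * L2_set (\<lambda>i. X i \<omega>) {..<n})\<^sup>2 / 2)
        \<le> (\<Sum>i<n. 1 - exp (- (s * X i \<omega>)\<^sup>2 / 2))" for \<omega>
      unfolding exp_L2_set_eq_prod by (rule one_minus_prod_le_sum) auto
  qed
  also have "\<dots> = (\<Sum>i<n. \<integral>\<omega>. 1 - exp (- (s * X i \<omega>)\<^sup>2 / 2) \<partial>M)"
    using int by (intro Bochner_Integration.integral_sum) auto
  also have "\<dots> \<le> (\<Sum>i<n. 2 * (1 * s) powr p)"
    using p s by (intro sum_mono stable_law_defect_bounds(1)[OF stable_vector_coordinate[OF sv]]) auto
  finally show ?thesis by simp
qed

text \<open>For this \<open>s\<close> one has \<open>s powr p = 1 / n\<close>. Each of the n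
  independent factors then has mean at most \<open>1 - 1 / (10 * n)\<close>, hence at most
  \<open>exp (- (1 / (10 * n)))\<close>, and the product stays below the constant
  \<open>exp (- (1 / 10))\<close>.\<close>

lemma norm_defect_ge:
  assumes sv: "stable_vector p n M X" and p: "0 < p" "p < 2" and n: "0 < n"
    and s: "s = real n powr (- 1 / p)"
  shows "1 / 20 \<le> (\<integral>\<omega>. 1 - exp (- (s * L2_set (\<lambda>i. X i \<omega>) {..<n})\<^sup>2 / 2) \<partial>M)"
proof -
  interpret prob_space M using stable_vectorD[OF sv] by simp
  note X [measurable] = stable_vectorD(3)[OF sv]
  note L2_set_measurable[OF sv, measurable]
  have "s powr p = real n powr (- 1)" using p by (simp add: s powr_powr)
  then have sp: "s powr p = 1 / real n" using n by (simp add: powr_minus_divide)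
  have s01: "0 \<le> s" "s \<le> 1" using p n unfolding s
    by (auto simp: powr_minus_divide ge_one_powr_ge_zero)
  have int: "integrable M (\<lambda>\<omega>. exp (- (s * X i \<omega>)\<^sup>2 / 2))" if "i < n" for i
    using X[OF that] by (intro integrable_const_bound[where B = 1]) auto
  have int': "integrable M (\<lambda>\<omega>. exp (- (s * L2_set (\<lambda>i. X i \<omega>) {..<n})\<^sup>2 / 2))"
    by (intro integrable_const_bound[where B = 1]) auto
  have "(\<integral>\<omega>. exp (- (s * L2_set (\<lambda>i. X i \<omega>) {..<n})\<^sup>2 / 2) \<partial>M)
      = (\<integral>\<omega>. (\<Prod>i<n. exp (- (s * X i \<omega>)\<^sup>2 / 2)) \<partial>M)"
    by (simp only: exp_L2_set_eq_prod)
  also have "\<dots> = (\<Prod>i<n. \<integral>\<omega>. exp (- (s * X i \<omega>)\<^sup>2 / 2) \<partial>M)"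
  proof (rule indep_vars_lebesgue_integral)
    show "indep_vars (\<lambda>_. borel) (\<lambda>i \<omega>. exp (- (s * X i \<omega>)\<^sup>2 / 2)) {..<n}"
      by (rule indep_vars_compose2[OF stable_vectorD(2)[OF sv]]) auto
  qed (use int in auto)
  also have "\<dots> \<le> (\<Prod>i<n. exp (- (1 / (10 * real n))))"
  proof (rule prod_mono, safe)
    fix i assume i: "i < n"
    show "0 \<le> (\<integral>\<omega>. exp (- (s * X i \<omega>)\<^sup>2 / 2) \<partial>M)" by simp
    have "(1 * s) powr p / 10 \<le> (\<integral>\<omega>. 1 - exp (- (s * X i \<omega>)\<^sup>2 / 2) \<partial>M)"
      using p s01 by (intro stable_law_defect_bounds(2)[OF stable_vector_coordinate[OF sv i]]) auto
    also have "\<dots> = 1 - (\<integral>\<omega>. exp (- (s * X i \<omega>)\<^sup>2 / 2) \<partial>M)"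
      using int[OF i] prob_space by simp
    finally have "(\<integral>\<omega>. exp (- (s * X i \<omega>)\<^sup>2 / 2) \<partial>M) \<le> 1 - 1 / (10 * real n)"
      by (simp add: sp)
    also have "\<dots> \<le> exp (- (1 / (10 * real n)))"
      using exp_ge_add_one_self[of "- (1 / (10 * real n))"] by linarith
    finally show "(\<integral>\<omega>. exp (- (s * X i \<omega>)\<^sup>2 / 2) \<partial>M) \<le> exp (- (1 / (10 * real n)))" .
  qed
  also have "\<dots> = exp (- (1 / 10))"
    using n by (simp flip: exp_of_nat_mult)
  finally have le: "(\<integral>\<omega>. exp (- (s * L2_set (\<lambda>i. X i \<omega>) {..<n})\<^sup>2 / 2) \<partial>M) \<le> exp (- (1 / 10))" .
  have "1 / 20 \<le> 1 - exp (- (1 / 10 :: real))"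
    using one_minus_exp_bounds(2)[of "1 / 10"] by simp
  also have "\<dots> \<le> (\<integral>\<omega>. 1 - exp (- (s * L2_set (\<lambda>i. X i \<omega>) {..<n})\<^sup>2 / 2) \<partial>M)"
    using le int' prob_space by simp
  finally show ?thesis .
qed

text \<open>If \<open>x > a\<close>, there is k with
  \<open>2 ^ k * a \<le> x < 2 ^ Suc k * a\<close>, and the k-th summand alone dominates
  \<open>x\<close>. The function \<open>\<phi>\<close> stands in for the indicator of [1,
  \<infinity>), so that a majorant with a known mean may be used.\<close>

lemma ennreal_le_dyadic_suminf:
  fixes x a :: real and \<phi> :: "real \<Rightarrow> real"
  assumes "0 < a" and \<phi>: "\<And>y. 1 \<le> y \<Longrightarrow> 1 \<le> \<phi> y"
  shows "ennreal x \<le> ennreal a + (\<Sum>k. ennreal (2 ^ Suc k * a * \<phi> (x / (2 ^ k * a))))"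
proof (cases "x \<le> a")
  case True
  then show ?thesis by (intro add_increasing2 ennreal_leI) auto
next
  case False
  have ex: "\<exists>m. x < 2 ^ m * a"
    using real_arch_pow[of 2 "x / a"] assms by (auto simp: field_simps)
  define m where "m = (LEAST m. x < 2 ^ m * a)"
  have m: "x < 2 ^ m * a" unfolding m_def by (rule LeastI_ex[OF ex])
  with False have "m \<noteq> 0" by (intro notI) simp
  then obtain k where k: "m = Suc k" using not0_implies_Suc by blast
  have "\<not> x < 2 ^ k * a" using not_less_Least[of k "\<lambda>m. x < 2 ^ m * a"] by (simp add: m_def[symmetric] k)
  then have "1 \<le> x / (2 ^ k * a)" using assms by (simp add: field_simps)
  then have "2 ^ Suc k * a * 1 \<le> 2 ^ Suc k * a * \<phi> (x / (2 ^ k * a))"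
    using assms by (intro mult_left_mono) auto
  moreover have "x \<le> 2 ^ Suc k * a * 1" using m k by simp
  ultimately have "ennreal x \<le> ennreal (2 ^ Suc k * a * \<phi> (x / (2 ^ k * a)))"
    by (intro ennreal_leI) (rule order_trans)
  also have "\<dots> \<le> (\<Sum>k. ennreal (2 ^ Suc k * a * \<phi> (x / (2 ^ k * a))))"
    using sum_le_suminf[of "\<lambda>k. ennreal (2 ^ Suc k * a * \<phi> (x / (2 ^ k * a)))" "{k}"] by simp
  finally show ?thesis by (simp add: add_increasing)
qed

text \<open>With \<open>a powr p = n\<close> the k-th dyadic layer has mean at most
  \<open>16 * a * \<rho> ^ k\<close>, where \<open>\<rho> = 2 powr (1 - p) < 1\<close> because p >
  1, so the series is geometric. Bounding the nonnegative integral first lets integrability be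
  deduced from it.\<close>

lemma nn_integral_norm_le:
  assumes sv: "stable_vector p n M X" and p: "1 < p" "p < 2" and n: "0 < n"
  shows "(\<integral>\<^sup>+\<omega>. ennreal (L2_set (\<lambda>i. X i \<omega>) {..<n}) \<partial>M)
    \<le> ennreal ((1 + 16 / (1 - 2 powr (1 - p))) * real n powr (1 / p))"
proof -
  interpret prob_space M using stable_vectorD[OF sv] by simp
  define N where "N \<omega> = L2_set (\<lambda>i. X i \<omega>) {..<n}" for \<omega>
  have N [measurable]: "N \<in> borel_measurable M"
    using L2_set_measurable[OF sv] by (simp add: N_def[abs_def])
  define a where "a = real n powr (1 / p)"
  have a: "0 < a" "a powr p = real n" using n p by (auto simp: a_def powr_powr)
  \<comment> \<open>The factor 4 makes \<open>\<phi>\<close> at least 1 on [1, \<infinity>), as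
    \<open>1 - exp (- (1 / 2)) \<ge> 1 / 4\<close>.\<close>
  define \<phi> where "\<phi> y = 4 * (1 - exp (- y\<^sup>2 / 2))" for y :: real
  define \<rho> where "\<rho> = 2 powr (1 - p)"
  have \<rho>: "0 < \<rho>" "\<rho> < 1" using p by (auto simp: \<rho>_def powr_less_one)
  have \<phi>1: "1 \<le> \<phi> y" if "1 \<le> y" for y
  proof -
    have "1 / 2 / 2 \<le> 1 - exp (- (1 / 2 :: real))" by (rule one_minus_exp_bounds) auto
    also have "\<dots> \<le> 1 - exp (- y\<^sup>2 / 2)" using that by simp
    finally show ?thesis by (simp add: \<phi>_def)
  qed
  have \<phi>0: "0 \<le> \<phi> y" for y by (simp add: \<phi>_def)
  have [measurable]: "\<phi> \<in> borel_measurable borel" by (simp add: \<phi>_def[abs_def])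
  have term_le: "(\<integral>\<^sup>+\<omega>. ennreal (2 ^ Suc k * a * \<phi> (N \<omega> / (2 ^ k * a))) \<partial>M) \<le> ennreal (16 * a * \<rho> ^ k)" for k
  proof -
    have int: "integrable M (\<lambda>\<omega>. \<phi> (N \<omega> / (2 ^ k * a)))"
      by (intro integrable_const_bound[where B = 4]) (auto simp: \<phi>_def)
    have "(\<integral>\<omega>. \<phi> (N \<omega> / (2 ^ k * a)) \<partial>M) =
        4 * (\<integral>\<omega>. 1 - exp (- (1 / (2 ^ k * a) * N \<omega>)\<^sup>2 / 2) \<partial>M)"
      by (simp only: \<phi>_def integral_mult_right_zero times_divide_eq_left mult_1_left)
    also have "\<dots> \<le> 4 * (2 * real n * (1 / (2 ^ k * a)) powr p)"
      unfolding N_def using p a by (intro mult_left_mono norm_defect_le[OF sv]) auto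
    finally have "2 ^ Suc k * a * (\<integral>\<omega>. \<phi> (N \<omega> / (2 ^ k * a)) \<partial>M)
        \<le> 2 ^ Suc k * a * (4 * (2 * real n * (1 / (2 ^ k * a)) powr p))"
      using a by (intro mult_left_mono) auto
    also have "\<dots> = 16 * a * \<rho> ^ k"
    proof -
      have "(1 / (2 ^ k * a)) powr p = 1 / ((2 powr p) ^ k * real n)"
        using a by (simp add: powr_divide powr_mult powr_realpow[symmetric] powr_powr mult.commute)
      moreover have "\<rho> ^ k = 2 ^ k / (2 powr p) ^ k"
        by (simp add: \<rho>_def powr_diff power_divide)
      ultimately show ?thesis using n by simp
    qed
    finally have "ennreal (2 ^ Suc k * a * (\<integral>\<omega>. \<phi> (N \<omega> / (2 ^ k * a)) \<partial>M)) \<le> ennreal (16 * a * \<rho> ^ k)"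
      by (rule ennreal_leI)
    moreover have "(\<integral>\<^sup>+\<omega>. ennreal (2 ^ Suc k * a * \<phi> (N \<omega> / (2 ^ k * a))) \<partial>M)
        = ennreal (\<integral>\<omega>. 2 ^ Suc k * a * \<phi> (N \<omega> / (2 ^ k * a)) \<partial>M)"
      using int a \<phi>0 by (intro nn_integral_eq_integral integrable_mult_right) auto
    ultimately show ?thesis by simp
  qed
  have "(\<integral>\<^sup>+\<omega>. ennreal (N \<omega>) \<partial>M)
      \<le> (\<integral>\<^sup>+\<omega>. ennreal a + (\<Sum>k. ennreal (2 ^ Suc k * a * \<phi> (N \<omega> / (2 ^ k * a)))) \<partial>M)"
    by (intro nn_integral_mono ennreal_le_dyadic_suminf a \<phi>1)
  also have "\<dots> = ennreal a + (\<Sum>k. \<integral>\<^sup>+\<omega>. ennreal (2 ^ Suc k * a * \<phi> (N \<omega> / (2 ^ k * a))) \<partial>M)"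
    by (simp add: nn_integral_add nn_integral_suminf emeasure_space_1)
  also have "\<dots> \<le> ennreal a + (\<Sum>k. ennreal (16 * a * \<rho> ^ k))"
    by (intro add_left_mono suminf_le term_le) auto
  also have "(\<Sum>k. ennreal (16 * a * \<rho> ^ k)) = ennreal (16 * a * (1 / (1 - \<rho>)))"
    using \<rho> a by (intro suminf_ennreal_eq sums_mult geometric_sums) auto
  also have "ennreal a + \<dots> = ennreal ((1 + 16 / (1 - \<rho>)) * a)"
    using \<rho> a by (simp add: algebra_simps flip: ennreal_plus)
  finally show ?thesis by (simp add: N_def \<rho>_def a_def)
qed

lemma integrable_norm:
  assumes sv: "stable_vector p n M X" and p: "1 < p" "p < 2" and n: "0 < n"
  shows "integrable M (\<lambda>\<omega>. L2_set (\<lambda>i. X i \<omega>) {..<n})"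
  using nn_integral_norm_le[OF assms] L2_set_measurable[OF sv]
  by (intro integrableI_bounded) (auto intro: le_less_trans)

lemma norm_expectation_le:
  assumes sv: "stable_vector p n M X" and p: "1 < p" "p < 2" and n: "0 < n"
  shows "(\<integral>\<omega>. L2_set (\<lambda>i. X i \<omega>) {..<n} \<partial>M) \<le> (1 + 16 / (1 - 2 powr (1 - p))) * real n powr (1 / p)"
proof -
  have "2 powr (1 - p) < (1 :: real)" using p by (auto simp: powr_less_one)
  then have "0 \<le> (1 + 16 / (1 - 2 powr (1 - p))) * real n powr (1 / p)" by simp
  moreover have "ennreal (\<integral>\<omega>. L2_set (\<lambda>i. X i \<omega>) {..<n} \<partial>M) = (\<integral>\<^sup>+\<omega>. ennreal (L2_set (\<lambda>i. X i \<omega>) {..<n}) \<partial>M)"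
    using integrable_norm[OF assms] by (intro nn_integral_eq_integral[symmetric]) auto
  ultimately show ?thesis using nn_integral_norm_le[OF assms] by (metis ennreal_le_iff)
qed

text \<open>At \<open>s = n powr (- 1 / p)\<close> the mean of
  \<open>1 - exp (- y\<^sup>2 / 2)\<close> with \<open>y = s * N\<close> is at least 1/20. This
  function never exceeds \<open>y\<close>: it is at most \<open>y\<^sup>2 / 2\<close> and also below
  1.\<close>

lemma norm_expectation_ge:
  assumes sv: "stable_vector p n M X" and p: "1 < p" "p < 2" and n: "0 < n"
  shows "1 / 20 * real n powr (1 / p) \<le> (\<integral>\<omega>. L2_set (\<lambda>i. X i \<omega>) {..<n} \<partial>M)"
proof -
  interpret prob_space M using stable_vectorD[OF sv] by simp
  define N where "N \<omega> = L2_set (\<lambda>i. X i \<omega>) {..<n}" for \<omega>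
  have N [measurable]: "N \<in> borel_measurable M"
    using L2_set_measurable[OF sv] by (simp add: N_def[abs_def])
  define s where "s = real n powr (- 1 / p)"
  have s: "0 < s" using n by (simp add: s_def)
  have "1 / 20 \<le> (\<integral>\<omega>. 1 - exp (- (s * N \<omega>)\<^sup>2 / 2) \<partial>M)"
    unfolding N_def using p n by (intro norm_defect_ge[OF sv]) (auto simp: s_def)
  also have "\<dots> \<le> (\<integral>\<omega>. s * N \<omega> \<partial>M)"
  proof (rule integral_mono)
    show "integrable M (\<lambda>\<omega>. 1 - exp (- (s * N \<omega>)\<^sup>2 / 2))"
      by (intro integrable_const_bound[where B = 1]) auto
    show "integrable M (\<lambda>\<omega>. s * N \<omega>)"
      using integrable_norm[OF assms] by (simp add: N_def)
    fix \<omega>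
    define y where "y = s * N \<omega>"
    have y: "0 \<le> y" using s by (simp add: y_def N_def)
    show "1 - exp (- (s * N \<omega>)\<^sup>2 / 2) \<le> s * N \<omega>"
    proof (cases "y \<le> 1")
      case True
      have "1 - exp (- y\<^sup>2 / 2) \<le> y\<^sup>2 / 2" using one_minus_exp_bounds(1)[of "y\<^sup>2 / 2"] by simp
      also have "\<dots> \<le> y"
        using mult_left_mono[OF True y] y by (simp add: power2_eq_square)
      finally show ?thesis by (simp add: y_def)
    next
      case False
      then show ?thesis unfolding y_def[symmetric] using exp_gt_zero[of "- y\<^sup>2 / 2"] by linarith
    qed
  qed
  also have "\<dots> = s * (\<integral>\<omega>. N \<omega> \<partial>M)" by simp
  finally have "1 / 20 \<le> s * (\<integral>\<omega>. N \<omega> \<partial>M)" .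
  then have "1 / 20 * real n powr (1 / p) \<le> s * (\<integral>\<omega>. N \<omega> \<partial>M) * real n powr (1 / p)"
    by (intro mult_right_mono) auto
  also have "\<dots> = (s * real n powr (1 / p)) * (\<integral>\<omega>. N \<omega> \<partial>M)" by (simp only: mult_ac)
  also have "s * real n powr (1 / p) = 1" using n by (simp add: s_def flip: powr_add)
  finally show ?thesis by (simp add: N_def)
qed

section \<open>Orthonormal families and random signs\<close>

text \<open>Fewer homogeneous equations than unknowns leave a nonzero solution, by Gaussian
  elimination. The induction runs over a bound \<open>k\<close> on the number of equations because
  different equations may coincide after elimination.\<close>

lemma exists_nonzero_orthogonal:
  fixes F :: "('i \<Rightarrow> real) set"
  assumes "finite I" "finite F" "card F \<le> k" "k < card I"
  shows "\<exists>x. (\<exists>i\<in>I. x i \<noteq> 0) \<and> (\<forall>i. i \<notin> I \<longrightarrow> x i = 0) \<and> (\<forall>f\<in>F. (\<Sum>i\<in>I. f i * x i) = 0)"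
  using assms
proof (induction k arbitrary: F I)
  case 0
  then obtain i where "i \<in> I" by (metis card_gt_0_iff ex_in_conv)
  with 0 show ?case by (intro exI[of _ "\<lambda>j. if j = i then 1 else 0"]) auto
next
  case (Suc k)
  show ?case
  proof (cases "F = {}")
    case True
    obtain i where "i \<in> I" using Suc.prems by (metis card_gt_0_iff ex_in_conv less_nat_zero_code neq0_conv)
    with True show ?thesis by (intro exI[of _ "\<lambda>j. if j = i then 1 else 0"]) auto
  next
    case False
    then obtain f where f: "f \<in> F" by auto
    define F0 where "F0 = F - {f}"
    have F0: "finite F0" "card F0 \<le> k" using Suc.prems f by (auto simp: F0_def)
    show ?thesis
    proof (cases "\<forall>i\<in>I. f i = 0")
      case True
      obtain x where "\<exists>i\<in>I. x i \<noteq> 0" "\<forall>i. i \<notin> I \<longrightarrow> x i = 0" "\<forall>g\<in>F0. (\<Sum>i\<in>I. g i * x i) = 0"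
        using Suc.IH[OF Suc.prems(1) F0] Suc.prems by auto
      with True show ?thesis by (intro exI[of _ x]) (auto simp: F0_def)
    next
      case False
      then obtain j where j: "j \<in> I" "f j \<noteq> 0" by auto
      \<comment> \<open>Multiples of \<open>f\<close> are subtracted so that the other equations
        lose their coefficient at the pivot \<open>j\<close>.\<close>
      define G where "G = (\<lambda>g i. g i - g j / f j * f i) ` F0"
      have "finite (I - {j})" "finite G" "card G \<le> k" "k < card (I - {j})"
        using Suc.prems j F0 card_image_le[OF F0(1)] by (auto simp: G_def intro: order_trans)
      from Suc.IH[OF this] obtain x where x: "\<exists>i\<in>I - {j}. x i \<noteq> 0"
        "\<forall>i. i \<notin> I - {j} \<longrightarrow> x i = 0" "\<forall>g\<in>G. (\<Sum>i\<in>I - {j}. g i * x i) = 0" by blast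
      \<comment> \<open>Back substitution: the value at \<open>j\<close> is the one that solves the
        equation of \<open>f\<close>.\<close>
      define y where "y = x(j := - (\<Sum>i\<in>I - {j}. f i * x i) / f j)"
      have split: "(\<Sum>i\<in>I. g i * y i) = g j * y j + (\<Sum>i\<in>I - {j}. g i * x i)" for g :: "'i \<Rightarrow> real"
      proof -
        have "(\<Sum>i\<in>I. g i * y i) = g j * y j + (\<Sum>i\<in>I - {j}. g i * y i)"
          using Suc.prems j by (intro sum.remove)
        also have "(\<Sum>i\<in>I - {j}. g i * y i) = (\<Sum>i\<in>I - {j}. g i * x i)"
          by (intro sum.cong) (auto simp: y_def)
        finally show ?thesis .
      qed
      have "(\<Sum>i\<in>I. g i * y i) = 0" if "g \<in> F" for g
      proof (cases "g = f")
        case True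
        then show ?thesis using j by (simp add: split) (simp add: y_def)
      next
        case False
        then have "(\<lambda>i. g i - g j / f j * f i) \<in> G" using that by (auto simp: G_def F0_def)
        then have "(\<Sum>i\<in>I - {j}. (g i - g j / f j * f i) * x i) = 0"
          by (rule bspec[OF x(3)])
        then show ?thesis unfolding split
          by (simp add: y_def algebra_simps sum_subtractf sum_distrib_left sum_divide_distrib)
      qed
      moreover have "\<exists>i\<in>I. y i \<noteq> 0" "\<forall>i. i \<notin> I \<longrightarrow> y i = 0"
        using x j by (auto simp: y_def)
      ultimately show ?thesis by blast
    qed
  qed
qed

lemma exists_unit_orthogonal:
  fixes F :: "('i \<Rightarrow> real) set"
  assumes "finite I" "finite F" "card F < card I"
  shows "\<exists>x. (\<Sum>i\<in>I. x i * x i) = 1 \<and> (\<forall>i. i \<notin> I \<longrightarrow> x i = 0) \<and> (\<forall>f\<in>F. (\<Sum>i\<in>I. f i * x i) = 0)"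
proof -
  obtain x where x: "\<exists>i\<in>I. x i \<noteq> 0" "\<forall>i. i \<notin> I \<longrightarrow> x i = 0"
    "\<forall>f\<in>F. (\<Sum>i\<in>I. f i * x i) = 0"
    using exists_nonzero_orthogonal[OF assms(1,2) order_refl assms(3)] by blast
  define r where "r = L2_set x I"
  have "r \<noteq> 0" using x assms by (auto simp: r_def L2_set_eq_0_iff)
  then have r: "0 < r" by (simp add: r_def less_le)
  have "(\<Sum>i\<in>I. x i / r * (x i / r)) = (\<Sum>i\<in>I. (x i)\<^sup>2) / r\<^sup>2"
    by (simp add: sum_divide_distrib power2_eq_square)
  also have "\<dots> = 1" using r by (simp add: r_def L2_set_def sum_nonneg)
  finally show ?thesis using x
    by (intro exI[of _ "\<lambda>i. x i / r"]) (auto simp flip: sum_divide_distrib)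
qed

text \<open>Unit vectors are added one at a time, each orthogonal to \<open>F\<close> and to the
  earlier ones. These are at most \<open>card F + m\<close> conditions, fewer than
  \<open>card I\<close>.\<close>

lemma exists_orthonormal_family:
  fixes F :: "('i \<Rightarrow> real) set"
  assumes "finite I" "finite F" "card F + m \<le> card I"
  shows "\<exists>v :: nat \<Rightarrow> 'i \<Rightarrow> real.
    (\<forall>j<m. \<forall>k<m. (\<Sum>i\<in>I. v j i * v k i) = (if j = k then 1 else 0)) \<and>
    (\<forall>j<m. \<forall>i. i \<notin> I \<longrightarrow> v j i = 0) \<and> (\<forall>j<m. \<forall>f\<in>F. (\<Sum>i\<in>I. f i * v j i) = 0)"
  using assms(3)
proof (induction m)
  case 0
  show ?case by simp
next
  case (Suc m)
  then have "card F + m \<le> card I" by simp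
  from Suc.IH[OF this] obtain v where
    "\<forall>j<m. \<forall>k<m. (\<Sum>i\<in>I. v j i * v k i) = (if j = k then 1 else 0)"
    "\<forall>j<m. \<forall>i. i \<notin> I \<longrightarrow> v j i = 0" "\<forall>j<m. \<forall>f\<in>F. (\<Sum>i\<in>I. f i * v j i) = 0" by blast
  then have v: "\<And>j k. j < m \<Longrightarrow> k < m \<Longrightarrow> (\<Sum>i\<in>I. v j i * v k i) = (if j = k then 1 else 0)"
    "\<And>j i. j < m \<Longrightarrow> i \<notin> I \<Longrightarrow> v j i = 0" "\<And>j f. j < m \<Longrightarrow> f \<in> F \<Longrightarrow> (\<Sum>i\<in>I. f i * v j i) = 0"
    by auto
  have "card (F \<union> v ` {..<m}) \<le> card F + m"
    using card_Un_le[of F "v ` {..<m}"] card_image_le[of "{..<m}" v] by simp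
  then have "card (F \<union> v ` {..<m}) < card I" using Suc.prems by simp
  then obtain x where x: "(\<Sum>i\<in>I. x i * x i) = 1" "\<forall>i. i \<notin> I \<longrightarrow> x i = 0"
    "\<forall>f\<in>F \<union> v ` {..<m}. (\<Sum>i\<in>I. f i * x i) = 0"
    using exists_unit_orthogonal[OF assms(1), of "F \<union> v ` {..<m}"] assms(2) by auto
  have vx: "(\<Sum>i\<in>I. v j i * x i) = 0" "(\<Sum>i\<in>I. x i * v j i) = 0" if "j < m" for j
    using x that by (auto simp: mult.commute)
  show ?case
    using x v vx by (intro exI[of _ "v(m := x)"]) (auto simp: less_Suc_eq)
qed

lemma sum_square_orthonormal:
  fixes v :: "nat \<Rightarrow> 'i \<Rightarrow> real"
  assumes v: "\<And>j k. j < m \<Longrightarrow> k < m \<Longrightarrow> (\<Sum>i\<in>I. v j i * v k i) = (if j = k then 1 else 0)"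
  shows "(\<Sum>i\<in>I. (\<Sum>j<m. b j * v j i)\<^sup>2) = (\<Sum>j<m. (b j)\<^sup>2)"
proof -
  have "(\<Sum>i\<in>I. (\<Sum>j<m. b j * v j i)\<^sup>2) = (\<Sum>i\<in>I. \<Sum>j<m. \<Sum>k<m. b j * b k * (v j i * v k i))"
    by (simp add: power2_eq_square sum_product mult_ac)
  also have "\<dots> = (\<Sum>j<m. \<Sum>k<m. \<Sum>i\<in>I. b j * b k * (v j i * v k i))"
    by (subst sum.swap, intro sum.cong refl, subst sum.swap, rule refl)
  also have "\<dots> = (\<Sum>j<m. \<Sum>k<m. b j * b k * (if j = k then 1 else 0))"
    by (intro sum.cong refl) (simp add: v flip: sum_distrib_left)
  also have "\<dots> = (\<Sum>j<m. (b j)\<^sup>2)"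
    by (intro sum.cong refl) (simp add: power2_eq_square if_distrib cong: if_cong)
  finally show ?thesis .
qed

lemma bessel_inequality_sum:
  fixes v :: "nat \<Rightarrow> 'i \<Rightarrow> real"
  assumes v: "\<And>j k. j < m \<Longrightarrow> k < m \<Longrightarrow> (\<Sum>i\<in>I. v j i * v k i) = (if j = k then 1 else 0)"
  shows "(\<Sum>j<m. (\<Sum>i\<in>I. t i * v j i)\<^sup>2) \<le> (\<Sum>i\<in>I. (t i)\<^sup>2)"
proof -
  define b where "b j = (\<Sum>i\<in>I. t i * v j i)" for j
  have 1: "(\<Sum>i\<in>I. t i * (\<Sum>j<m. b j * v j i)) = (\<Sum>j<m. (b j)\<^sup>2)"
  proof -
    have "(\<Sum>i\<in>I. t i * (\<Sum>j<m. b j * v j i)) = (\<Sum>i\<in>I. \<Sum>j<m. b j * (t i * v j i))"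
      by (simp add: sum_distrib_left mult_ac)
    also have "\<dots> = (\<Sum>j<m. \<Sum>i\<in>I. b j * (t i * v j i))" by (rule sum.swap)
    finally show ?thesis by (simp add: b_def power2_eq_square flip: sum_distrib_left)
  qed
  have 2: "(\<Sum>i\<in>I. (\<Sum>j<m. b j * v j i)\<^sup>2) = (\<Sum>j<m. (b j)\<^sup>2)"
    by (rule sum_square_orthonormal[OF v])
  \<comment> \<open>The squared distance from \<open>t\<close> to its projection onto the span of
    the \<open>v j\<close> is nonnegative.\<close>
  have "0 \<le> (\<Sum>i\<in>I. (t i - (\<Sum>j<m. b j * v j i))\<^sup>2)" by (intro sum_nonneg) simp
  also have "\<dots> = (\<Sum>i\<in>I. (t i)\<^sup>2) - 2 * (\<Sum>i\<in>I. t i * (\<Sum>j<m. b j * v j i)) + (\<Sum>i\<in>I. (\<Sum>j<m. b j * v j i)\<^sup>2)"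
    by (simp add: power2_diff sum.distrib sum_subtractf sum_distrib_left mult_ac)
  finally show ?thesis by (simp add: 1 2 flip: b_def)
qed

section \<open>Random signs: exponential moments and the union bound\<close>

lemma cosh_le_exp_half_square: "cosh x \<le> exp (x\<^sup>2 / 2)" for x :: real
proof -
  \<comment> \<open>Both sides are power series in \<open>x\<^sup>2\<close>; this inequality
    compares them term by term.\<close>
  have fact_ge: "2 ^ k * fact k \<le> (fact (2 * k) :: real)" for k
  proof (induction k)
    case (Suc k)
    have "2 ^ Suc k * fact (Suc k) = (2 * real (Suc k)) * (2 ^ k * fact k :: real)" by simp
    also have "\<dots> \<le> (2 * real (Suc k)) * (fact (2 * k) * real (Suc (2 * k)))"
    proof (intro mult_left_mono)
      have "2 ^ k * fact k \<le> (fact (2 * k) :: real) * 1" using Suc by simp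
      also have "\<dots> \<le> fact (2 * k) * real (Suc (2 * k))" by (intro mult_left_mono) auto
      finally show "2 ^ k * fact k \<le> fact (2 * k) * real (Suc (2 * k))" .
    qed simp
    also have "\<dots> = fact (2 * Suc k)" by (simp add: algebra_simps)
    finally show ?case .
  qed simp
  have exp_sums: "(\<lambda>k. y ^ k / fact k) sums exp y" for y :: real
    using exp_converges[of y] by (simp add: divide_inverse mult.commute)
  have *: "(if even n then x ^ n /\<^sub>R fact n else 0) = 0" if "n \<notin> range (\<lambda>k. 2 * k)" for n
    using that by (auto elim!: evenE)
  have cosh_sums: "(\<lambda>k. x ^ (2 * k) / fact (2 * k)) sums cosh x"
    using cosh_converges[of x]
      sums_mono_reindex[of "\<lambda>k. 2 * k" "\<lambda>n. if even n then x ^ n /\<^sub>R fact n else 0" "cosh x", OF _ *]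
    by (simp add: strict_mono_def divide_inverse_commute)
  have exp_half_sums: "(\<lambda>k. (x\<^sup>2 / 2) ^ k / fact k) sums exp (x\<^sup>2 / 2)"
    by (rule exp_sums)
  have "x ^ (2 * k) / fact (2 * k) \<le> (x\<^sup>2 / 2) ^ k / fact k" for k
  proof -
    have "x ^ (2 * k) / fact (2 * k) \<le> x ^ (2 * k) / (2 ^ k * fact k)"
      using fact_ge[of k] by (intro divide_left_mono) auto
    then show ?thesis by (simp add: power_mult power_divide)
  qed
  then show ?thesis by (rule sums_le[OF _ cosh_sums exp_half_sums])
qed

text \<open>Extensional functions, fixed outside \<open>{..<m}\<close>, form a finite set of exactly
  \<open>2 ^ m\<close> points, so that probabilities of random signs become cardinalities.\<close>

definition sign_vectors :: "nat \<Rightarrow> (nat \<Rightarrow> real) set" where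
  "sign_vectors m = PiE {..<m} (\<lambda>_. {-1, 1})"

lemma finite_sign_vectors [simp]: "finite (sign_vectors m)"
  by (simp add: sign_vectors_def finite_PiE)

lemma card_sign_vectors: "card (sign_vectors m) = 2 ^ m"
  by (simp add: sign_vectors_def card_PiE numeral_2_eq_2)

text \<open>Up to the factor \<open>2 ^ m\<close> the left side is the moment generating function of
  a random signed sum, which factors into the values \<open>cosh (b j)\<close>.\<close>

lemma sum_exp_sign_vectors_le:
  "(\<Sum>\<xi>\<in>sign_vectors m. exp (\<Sum>j<m. \<xi> j * b j)) \<le> 2 ^ m * exp ((\<Sum>j<m. (b j)\<^sup>2) / 2)"
proof -
  have "(\<Sum>\<xi>\<in>sign_vectors m. exp (\<Sum>j<m. \<xi> j * b j)) =
      (\<Sum>\<xi>\<in>PiE {..<m} (\<lambda>_. {-1, 1}). \<Prod>j<m. exp (\<xi> j * b j))"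
    by (simp add: sign_vectors_def exp_sum)
  also have "\<dots> = (\<Prod>j<m. \<Sum>e\<in>{-1, 1}. exp (e * b j))"
    by (rule prod_sum_PiE[symmetric]) auto
  also have "\<dots> = (\<Prod>j<m. 2 * cosh (b j))"
    by (intro prod.cong) (auto simp: cosh_def)
  also have "\<dots> \<le> (\<Prod>j<m. 2 * exp ((b j)\<^sup>2 / 2))"
    by (intro prod_mono) (auto intro: cosh_le_exp_half_square order_trans[OF _ cosh_real_ge_1])
  also have "\<dots> = 2 ^ m * exp ((\<Sum>j<m. (b j)\<^sup>2) / 2)"
    by (simp add: prod.distrib exp_sum sum_divide_distrib)
  finally show ?thesis .
qed

text \<open>Hoeffding's inequality in counting form, by the exponential Markov bound for the sum and
  its negative.\<close>

lemma card_large_sign_sums_le: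
  assumes B: "(\<Sum>j<m. (b j)\<^sup>2) \<le> B" "0 < B" and \<theta>: "0 < \<theta>"
  shows "real (card {\<xi>\<in>sign_vectors m. \<theta> \<le> \<bar>\<Sum>j<m. \<xi> j * b j\<bar>}) \<le> 2 ^ m * (2 * exp (- \<theta>\<^sup>2 / (2 * B)))"
proof -
  \<comment> \<open>This value minimises the exponent
    \<open>- (l * \<theta>) + l\<^sup>2 * B / 2\<close>.\<close>
  define l where "l = \<theta> / B"
  have l: "0 < l" using assms by (simp add: l_def)
  \<comment> \<open>The condition on \<open>c\<close> admits both \<open>l\<close> and
    \<open>- l\<close>.\<close>
  have mgf: "(\<Sum>\<xi>\<in>sign_vectors m. exp (c * (\<Sum>j<m. \<xi> j * b j))) \<le> 2 ^ m * exp (l\<^sup>2 * B / 2)"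
    if "c\<^sup>2 = l\<^sup>2" for c
  proof -
    have "(\<Sum>\<xi>\<in>sign_vectors m. exp (c * (\<Sum>j<m. \<xi> j * b j))) \<le> 2 ^ m * exp ((\<Sum>j<m. (c * b j)\<^sup>2) / 2)"
      using sum_exp_sign_vectors_le[where m = m and b = "\<lambda>j. c * b j"] by (simp add: sum_distrib_left mult_ac)
    also have "(\<Sum>j<m. (c * b j)\<^sup>2) = l\<^sup>2 * (\<Sum>j<m. (b j)\<^sup>2)"
      by (simp add: power_mult_distrib that sum_distrib_left)
    also have "2 ^ m * exp (l\<^sup>2 * (\<Sum>j<m. (b j)\<^sup>2) / 2) \<le> 2 ^ m * exp (l\<^sup>2 * B / 2)"
      using B by (intro mult_left_mono) (auto intro!: divide_right_mono mult_left_mono)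
    finally show ?thesis .
  qed
  let ?bad = "{\<xi>\<in>sign_vectors m. \<theta> \<le> \<bar>\<Sum>j<m. \<xi> j * b j\<bar>}"
  let ?w = "\<lambda>\<xi>. exp (- (l * \<theta>)) * (exp (l * (\<Sum>j<m. \<xi> j * b j)) + exp (- l * (\<Sum>j<m. \<xi> j * b j)))"
  have "real (card ?bad) = (\<Sum>\<xi>\<in>?bad. 1)" by simp
  also have "\<dots> \<le> (\<Sum>\<xi>\<in>?bad. ?w \<xi>)"
  proof (rule sum_mono)
    fix \<xi> assume "\<xi> \<in> ?bad"
    define y where "y = (\<Sum>j<m. \<xi> j * b j)"
    have "\<theta> \<le> \<bar>y\<bar>" using \<open>\<xi> \<in> ?bad\<close> by (simp add: y_def)
    then have "exp (l * \<theta>) \<le> exp (l * \<bar>y\<bar>)" using l by simp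
    also have "\<dots> \<le> exp (l * y) + exp (- l * y)" by (cases "0 \<le> y") auto
    finally have "exp (- (l * \<theta>)) * exp (l * \<theta>) \<le> exp (- (l * \<theta>)) * (exp (l * y) + exp (- l * y))"
      by (intro mult_left_mono) auto
    then show "1 \<le> ?w \<xi>" by (simp add: y_def flip: exp_add)
  qed
  also have "\<dots> \<le> (\<Sum>\<xi>\<in>sign_vectors m. ?w \<xi>)"
    by (intro sum_mono2) auto
  also have "\<dots> = exp (- (l * \<theta>)) * ((\<Sum>\<xi>\<in>sign_vectors m. exp (l * (\<Sum>j<m. \<xi> j * b j)))
      + (\<Sum>\<xi>\<in>sign_vectors m. exp (- l * (\<Sum>j<m. \<xi> j * b j))))"
    by (simp only: sum_distrib_left sum.distrib[symmetric])
  also have "\<dots> \<le> exp (- (l * \<theta>)) * (2 ^ m * exp (l\<^sup>2 * B / 2) + 2 ^ m * exp (l\<^sup>2 * B / 2))"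
    by (intro mult_left_mono add_mono mgf) auto
  also have "\<dots> = 2 ^ m * (2 * exp (- (l * \<theta>) + l\<^sup>2 * B / 2))"
    unfolding exp_add by simp
  also have "- (l * \<theta>) + l\<^sup>2 * B / 2 = - \<theta>\<^sup>2 / (2 * B)"
    using B by (simp add: l_def power2_eq_square field_simps)
  finally show ?thesis .
qed

text \<open>A union bound in which \<open>T\<close> may be infinite. If every sign vector failed,
  choosing one failing point for each would give a finite \<open>G\<close> whose bad sets cover all
  sign vectors, contrary to the sum being below 1.\<close>

lemma exists_sign_vector_small_sums:
  fixes b :: "'t \<Rightarrow> nat \<Rightarrow> real"
  assumes B: "\<And>t. t \<in> T \<Longrightarrow> (\<Sum>j<m. (b t j)\<^sup>2) \<le> B t" "\<And>t. t \<in> T \<Longrightarrow> 0 < B t" and \<theta>: "0 < \<theta>"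
    and sum: "\<And>G. finite G \<Longrightarrow> G \<subseteq> T \<Longrightarrow> (\<Sum>t\<in>G. 2 * exp (- \<theta>\<^sup>2 / (2 * B t))) < 1"
  shows "\<exists>\<xi>\<in>sign_vectors m. \<forall>t\<in>T. \<bar>\<Sum>j<m. \<xi> j * b t j\<bar> < \<theta>"
proof (rule ccontr)
  assume "\<not> ?thesis"
  then have "\<forall>\<xi>\<in>sign_vectors m. \<exists>t\<in>T. \<theta> \<le> \<bar>\<Sum>j<m. \<xi> j * b t j\<bar>" by (auto simp: not_less)
  then obtain t where t: "\<And>\<xi>. \<xi> \<in> sign_vectors m \<Longrightarrow> t \<xi> \<in> T \<and> \<theta> \<le> \<bar>\<Sum>j<m. \<xi> j * b (t \<xi>) j\<bar>"
    by metis
  define G where "G = t ` sign_vectors m"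
  have G: "finite G" "G \<subseteq> T" using t by (auto simp: G_def)
  let ?bad = "\<lambda>t. {\<xi>\<in>sign_vectors m. \<theta> \<le> \<bar>\<Sum>j<m. \<xi> j * b t j\<bar>}"
  have "sign_vectors m \<subseteq> (\<Union>t\<in>G. ?bad t)" using t by (auto simp: G_def)
  then have "card (sign_vectors m) \<le> card (\<Union>t\<in>G. ?bad t)" using G by (intro card_mono) auto
  also have "\<dots> \<le> (\<Sum>t\<in>G. card (?bad t))" using G by (intro card_UN_le)
  finally have "real (2 ^ m) \<le> real (\<Sum>t\<in>G. card (?bad t))"
    unfolding card_sign_vectors by (rule of_nat_mono)
  then have "2 ^ m \<le> (\<Sum>t\<in>G. real (card (?bad t)))" by simp
  also have "\<dots> \<le> (\<Sum>t\<in>G. 2 ^ m * (2 * exp (- \<theta>\<^sup>2 / (2 * B t))))"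
    using G B \<theta> by (intro sum_mono card_large_sign_sums_le) auto
  also have "\<dots> = 2 ^ m * (\<Sum>t\<in>G. 2 * exp (- \<theta>\<^sup>2 / (2 * B t)))"
    by (simp only: sum_distrib_left)
  also have "\<dots> < 2 ^ m * 1"
    using sum[OF G] by (intro mult_strict_left_mono) auto
  finally show False by simp
qed

section \<open>Sets whose hull contains the ball\<close>

text \<open>Raise \<open>z / r \<le> exp (z / r)\<close> to the power \<open>r\<close>. This trades
  the sub-Gaussian tails for powers of the lengths of the points, whose p-th powers have a bounded
  sum.\<close>

lemma exp_minus_le_powr:
  fixes z r :: real
  assumes "0 < z" "0 < r"
  shows "exp (- z) \<le> (r / z) powr r"
proof -
  have "z / r \<le> exp (z / r)" using exp_ge_add_one_self[of "z / r"] by linarith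
  then have "(z / r) powr r \<le> exp (z / r) powr r" using assms by (intro powr_mono2) auto
  also have "\<dots> = exp z" using assms by (simp add: powr_def)
  finally have "exp (- z) \<le> inverse ((z / r) powr r)"
    using assms by (simp add: exp_minus)
  also have "\<dots> = (r / z) powr r"
    using assms by (simp add: powr_divide inverse_eq_divide)
  finally show ?thesis .
qed

text \<open>
  Chosen such that the union bound in the next proof gives exactly \<open>(1/2)\<^sup>q\<close>, where \<open>q = p / (p - 1)\<close>
  is the conjugate exponent.
\<close>

definition net_scale :: "real \<Rightarrow> real" where
  "net_scale p = 1 / (2 * sqrt (8 * (p / (p - 1))) * 2 powr (1 / p))"

lemma net_scale_pos: "1 < p \<Longrightarrow> 0 < net_scale p"
  by (simp add: net_scale_def)

lemma exists_direction_with_small_marginals: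
  fixes S :: "(nat \<Rightarrow> real) set"
  assumes p: "1 < p" "p < 2" and n: "0 < n" "even n"
    and sum: "\<And>G. finite G \<Longrightarrow> G \<subseteq> S \<Longrightarrow> (\<Sum>t\<in>G. L2_set t {..<n} powr p) \<le> R powr p"
    and R: "0 < R" "R \<le> net_scale p * real n powr (2 / p - 1 / 2)"
  shows "\<exists>x \<beta>. x \<in> Rn n \<and> \<beta> < L2_set x {..<n} \<and> (\<forall>t\<in>S. \<bar>\<Sum>i<n. t i * x i\<bar> \<le> \<beta>)"
proof -
  define a where "a t = L2_set t {..<n}" for t :: "nat \<Rightarrow> real"
  have a0: "0 \<le> a t" for t by (simp add: a_def)
  define m where "m = n div 2"
  have nm: "real n = 2 * real m" and m: "0 < m" using n by (auto simp: m_def elim!: evenE)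
  \<comment> \<open>In the union bound the exponent of \<open>n\<close> is
    \<open>1 + q / p - q\<close>, which vanishes exactly for this \<open>q\<close>.\<close>
  define q where "q = p / (p - 1)"
  have q: "2 < q" using p by (simp add: q_def field_simps)
  \<comment> \<open>The long points: more than \<open>m\<close> of them would have p-th powers
    summing to more than \<open>R powr p\<close>.\<close>
  define F where "F = {t\<in>S. R powr p / real m < a t powr p}"
  have card_le: "card G \<le> m" if "finite G" "G \<subseteq> F" for G
  proof -
    have "real (card G) * (R powr p / real m) \<le> (\<Sum>t\<in>G. a t powr p)"
      using that by (intro sum_bounded_below[where 'a = real, simplified]) (auto simp: F_def)
    also have "\<dots> \<le> R powr p" unfolding a_def using that by (intro sum) (auto simp: F_def)
    finally show ?thesis using R m by (simp add: field_simps)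
  qed
  have F: "finite F" "card F \<le> m"
  proof -
    show "finite F"
    proof (rule ccontr)
      assume "infinite F"
      then obtain G where "G \<subseteq> F" "finite G" "card G = Suc m"
        by (meson infinite_arbitrarily_large)
      then show False using card_le[of G] by simp
    qed
    then show "card F \<le> m" using card_le by blast
  qed
  \<comment> \<open>Points with \<open>a t = 0\<close> are set apart because the sub-Gaussian bound
    divides by \<open>(a t)\<^sup>2\<close>; every inner product with them is zero.\<close>
  define T where "T = {t\<in>S - F. a t \<noteq> 0}"
  have "card F + m \<le> card {..<n}" using F n by (auto simp: m_def)
  then obtain v :: "nat \<Rightarrow> nat \<Rightarrow> real" where
    v: "\<forall>j<m. \<forall>k<m. (\<Sum>i<n. v j i * v k i) = (if j = k then 1 else 0)"
      "\<forall>j<m. \<forall>i. i \<notin> {..<n} \<longrightarrow> v j i = 0" "\<forall>j<m. \<forall>f\<in>F. (\<Sum>i<n. f i * v j i) = 0"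
    using exists_orthonormal_family[of "{..<n}" F m] F by auto
  define b where "b t j = (\<Sum>i<n. t i * v j i)" for t j
  \<comment> \<open>Half of \<open>sqrt m\<close>, the length of every signed sum of the
    \<open>m\<close> orthonormal vectors.\<close>
  define \<theta> where "\<theta> = sqrt (real m) / 2"
  have \<theta>: "0 < \<theta>" "\<theta>\<^sup>2 = real m / 4" using m by (auto simp: \<theta>_def power_divide)
  have tail: "(\<Sum>t\<in>G. 2 * exp (- \<theta>\<^sup>2 / (2 * (a t)\<^sup>2))) < 1" if G: "finite G" "G \<subseteq> T" for G
  proof -
    \<comment> \<open>The exponential is bounded by a multiple of \<open>a t powr q\<close>. As q >
      p, the surplus power \<open>q - p\<close> is absorbed by the length threshold valid outside
      \<open>F\<close>, which leaves \<open>a t powr p\<close>.\<close>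
    define K where "K = 2 * (8 * q) powr (q / 2) * real n powr (- q / 2) * (R / real m powr (1 / p)) powr (q - p)"
    have "(\<Sum>t\<in>G. 2 * exp (- \<theta>\<^sup>2 / (2 * (a t)\<^sup>2))) \<le> (\<Sum>t\<in>G. K * a t powr p)"
    proof (rule sum_mono)
      fix t assume "t \<in> G"
      then have t: "0 < a t" "a t powr p \<le> R powr p / real m"
        using G a0[of t] by (auto simp: T_def F_def not_less)
      have at: "a t \<le> R / real m powr (1 / p)"
      proof -
        have "(a t powr p) powr (1 / p) \<le> (R powr p / real m) powr (1 / p)"
          using t p by (intro powr_mono2) auto
        then show ?thesis using t p R m by (simp add: powr_powr powr_divide)
      qed
      define z where "z = \<theta>\<^sup>2 / (2 * (a t)\<^sup>2)"
      have z: "0 < z" using \<theta> t by (simp add: z_def)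
      have qz: "q / 2 / z = 8 * q * (a t)\<^sup>2 / real n"
        using t m by (simp add: z_def \<theta> nm field_simps)
      have "exp (- z) \<le> (q / 2 / z) powr (q / 2)"
        using z q by (intro exp_minus_le_powr) auto
      also have "\<dots> = (8 * q) powr (q / 2) * real n powr (- q / 2) * a t powr q"
        using t q m unfolding qz powr_divide powr_mult
        by (simp add: powr_mult powr_divide powr_minus_divide powr_powr flip: powr_numeral)
      also have "a t powr q = a t powr (q - p) * a t powr p"
        using t by (simp flip: powr_add)
      also have "(8 * q) powr (q / 2) * real n powr (- q / 2) * (a t powr (q - p) * a t powr p)
          \<le> (8 * q) powr (q / 2) * real n powr (- q / 2) * ((R / real m powr (1 / p)) powr (q - p) * a t powr p)"
        using at t q p by (intro mult_left_mono mult_right_mono powr_mono2) auto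
      finally show "2 * exp (- \<theta>\<^sup>2 / (2 * (a t)\<^sup>2)) \<le> K * a t powr p"
        by (simp add: K_def z_def mult_ac)
    qed
    also have "\<dots> = K * (\<Sum>t\<in>G. a t powr p)" by (simp add: sum_distrib_left)
    also have "\<dots> \<le> K * R powr p"
      unfolding a_def using G by (intro mult_left_mono sum) (auto simp: K_def T_def)
    also have "\<dots> = 2 * (8 * q) powr (q / 2) * real n powr (- q / 2) * real m powr (1 - q / p) * R powr q"
    proof -
      have "(R / real m powr (1 / p)) powr (q - p) * R powr p = real m powr (1 - q / p) * R powr q"
      proof -
        have e: "1 - q / p = - ((q - p) / p)" using p by (simp add: field_simps)
        have "(R / real m powr (1 / p)) powr (q - p) = R powr (q - p) / real m powr ((q - p) / p)"
          using R by (simp add: powr_divide powr_powr)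
        moreover have "R powr (q - p) * R powr p = R powr q" using R by (simp flip: powr_add)
        ultimately show ?thesis unfolding e by (simp add: powr_minus divide_inverse mult_ac)
      qed
      then show ?thesis by (simp add: K_def mult.assoc)
    qed
    also have "\<dots> \<le> 2 * (8 * q) powr (q / 2) * real n powr (- q / 2) * real m powr (1 - q / p)
        * (net_scale p * real n powr (2 / p - 1 / 2)) powr q"
      using R q by (intro mult_left_mono powr_mono2) auto
    also have "\<dots> = (1 / 2) powr q"
    proof -
      have mn: "real m powr (1 - q / p) = real n powr (1 - q / p) * 2 powr (q / p - 1)"
      proof -
        have "real m = real n / 2" using nm by simp
        then have "real m powr e = real n powr e * 2 powr (- e)" for e
          by (simp only: powr_divide powr_minus_divide times_divide_eq_right mult_1_right)
        from this[of "1 - q / p"] show ?thesis by simp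
      qed
      have nn: "real n powr (- q / 2) * real n powr (1 - q / p) * real n powr ((2 / p - 1 / 2) * q) = 1"
      proof -
        have "- q / 2 + (1 - q / p) + (2 / p - 1 / 2) * q = 0"
        proof -
          have "q / p = q - 1" using p by (simp add: q_def field_simps)
          moreover have "(2 / p - 1 / 2) * q = 2 * (q / p) - q / 2" by (simp add: left_diff_distrib)
          ultimately show ?thesis by simp
        qed
        then show ?thesis using n by (simp flip: powr_add)
      qed
      have ns: "net_scale p powr q = (1 / 2) powr q * (8 * q) powr (- q / 2) * 2 powr (- q / p)"
        using q p unfolding net_scale_def q_def[symmetric]
        by (simp add: powr_divide powr_mult powr_powr powr_half_sqrt[symmetric] powr_minus_divide)
      have "2 * (8 * q) powr (q / 2) * real n powr (- q / 2) * real m powr (1 - q / p)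
        * (net_scale p * real n powr (2 / p - 1 / 2)) powr q =
        2 * (8 * q) powr (q / 2) * real n powr (- q / 2) * (real n powr (1 - q / p) * 2 powr (q / p - 1))
        * (net_scale p powr q * real n powr ((2 / p - 1 / 2) * q))"
        unfolding mn by (simp add: powr_mult powr_powr)
      also have "\<dots> = (real n powr (- q / 2) * real n powr (1 - q / p) * real n powr ((2 / p - 1 / 2) * q))
        * ((8 * q) powr (q / 2) * (8 * q) powr (- q / 2)) * (2 * 2 powr (q / p - 1) * 2 powr (- q / p)) * (1 / 2) powr q"
        unfolding ns by (simp only: mult_ac)
      also have "\<dots> = (1 / 2) powr q"
      proof -
        have "(8 * q) powr (q / 2) * (8 * q) powr (- q / 2) = 1" using q by (simp flip: powr_add)
        moreover have "2 * 2 powr (q / p - 1) * 2 powr (- q / p) = (1::real)"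
          by (simp add: powr_diff powr_minus_divide)
        ultimately show ?thesis unfolding nn by simp
      qed
      finally show ?thesis .
    qed
    also have "\<dots> < (1 / 2) powr 0" using q by (intro powr_less_mono') auto
    finally show ?thesis by simp
  qed
  have bessel: "(\<Sum>j<m. (b t j)\<^sup>2) \<le> (a t)\<^sup>2" for t
    unfolding b_def a_def L2_set_def using bessel_inequality_sum[where m = m and I = "{..<n}" and v = v and t = t] v
    by (simp add: sum_nonneg)
  have "\<exists>\<xi>\<in>sign_vectors m. \<forall>t\<in>T. \<bar>\<Sum>j<m. \<xi> j * b t j\<bar> < \<theta>"
    using bessel \<theta> tail by (intro exists_sign_vector_small_sums[where B = "\<lambda>t. (a t)\<^sup>2"]) (auto simp: T_def)
  then obtain \<xi> where \<xi>: "\<xi> \<in> sign_vectors m" "\<And>t. t \<in> T \<Longrightarrow> \<bar>\<Sum>j<m. \<xi> j * b t j\<bar> < \<theta>" by blast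
  define x where "x i = (\<Sum>j<m. \<xi> j * v j i)" for i
  have tx: "(\<Sum>i<n. t i * x i) = (\<Sum>j<m. \<xi> j * b t j)" for t
  proof -
    have "(\<Sum>i<n. t i * x i) = (\<Sum>i<n. \<Sum>j<m. \<xi> j * (t i * v j i))"
      by (simp add: x_def sum_distrib_left mult_ac)
    also have "\<dots> = (\<Sum>j<m. \<Sum>i<n. \<xi> j * (t i * v j i))" by (rule sum.swap)
    finally show ?thesis by (simp add: b_def sum_distrib_left)
  qed
  have "L2_set x {..<n} = sqrt (real m)"
  proof -
    have "(\<xi> j)\<^sup>2 = 1" if "j < m" for j
    proof -
      have "\<xi> j = - 1 \<or> \<xi> j = 1" using \<xi>(1) that by (auto simp: sign_vectors_def PiE_iff)
      then show ?thesis by auto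
    qed
    then have "(\<Sum>i<n. (x i)\<^sup>2) = real m"
      unfolding x_def using v by (subst sum_square_orthonormal) auto
    then show ?thesis by (simp add: L2_set_def)
  qed
  then have "\<theta> < L2_set x {..<n}" using m by (simp add: \<theta>_def)
  moreover have "\<bar>\<Sum>i<n. t i * x i\<bar> \<le> \<theta>" if "t \<in> S" for t
  proof -
    consider "t \<in> T" | "t \<in> F" | "a t = 0" using \<open>t \<in> S\<close> by (auto simp: T_def)
    then show ?thesis
    proof cases
      case 1
      then show ?thesis using \<xi>(2)[of t] by (simp add: tx)
    next
      case 2
      then have "b t j = 0" if "j < m" for j using v that by (auto simp: b_def)
      then show ?thesis using \<theta> by (simp add: tx)
    next
      case 3
      then have "t i = 0" if "i < n" for i using that by (simp add: a_def L2_set_eq_0_iff)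
      then show ?thesis using \<theta> by simp
    qed
  qed
  moreover have "x \<in> Rn n" using v by (auto simp: topspace_Euclidean_space x_def)
  ultimately show ?thesis by blast
qed

section \<open>Separation by coordinate halfspaces\<close>

lemma closed_convex_hull_minimal:
  assumes "A \<subseteq> C" "convex C" "closed C"
  shows "closed_convex_hull n A \<subseteq> C"
proof -
  have "convex hull A \<subseteq> C" using assms by (simp add: hull_minimal)
  then have "closed_convex_hull n A \<subseteq> Euclidean_space n closure_of C"
    unfolding closed_convex_hull_def by (rule closure_of_mono)
  \<comment> \<open>\<open>Euclidean_space n\<close> carries the subspace topology of the product,
    so a set closed in the whole product contains its closure there.\<close>
  also have "\<dots> \<subseteq> C"
    using assms(3) unfolding Euclidean_space_def euclidean_product_topology
    by (auto simp: closure_of_subtopology dest: subsetD[OF closure_minimal[OF Int_lower2 assms(3)]])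
  finally show ?thesis .
qed

lemma closed_coordinate_halfspace: "closed {y :: nat \<Rightarrow> real. (\<Sum>i<n. y i * x i) \<le> \<beta>}"
  by (intro closed_Collect_le continuous_intros continuous_on_product_coordinates)

lemma convex_coordinate_halfspace: "convex {y :: nat \<Rightarrow> real. (\<Sum>i<n. y i * x i) \<le> \<beta>}"
proof (rule convexI)
  fix y z :: "nat \<Rightarrow> real" and u v :: real
  assume yz: "y \<in> {y. (\<Sum>i<n. y i * x i) \<le> \<beta>}" "z \<in> {y. (\<Sum>i<n. y i * x i) \<le> \<beta>}"
    and uv: "0 \<le> u" "0 \<le> v" "u + v = 1"
  have "(\<Sum>i<n. (u *\<^sub>R y + v *\<^sub>R z) i * x i) = u * (\<Sum>i<n. y i * x i) + v * (\<Sum>i<n. z i * x i)"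
    by (simp add: algebra_simps sum.distrib sum_distrib_left)
  also have "\<dots> \<le> u * \<beta> + v * \<beta>" using yz uv by (intro add_mono mult_left_mono) auto
  also have "\<dots> = \<beta>" using uv by (simp flip: distrib_right)
  finally show "u *\<^sub>R y + v *\<^sub>R z \<in> {y. (\<Sum>i<n. y i * x i) \<le> \<beta>}" by simp
qed

text \<open>With \<open>y = x / r\<close>, where r is the length of \<open>x\<close>, the points
  \<open>y - t0\<close> and \<open>- y - t0\<close> are tested against \<open>x\<close> and
  \<open>- x\<close>. Writing d for the inner product of \<open>t0\<close> and \<open>x\<close>,
  this gives \<open>r - d \<le> \<beta>\<close> and \<open>r + d \<le> \<beta>\<close>; adding them
  eliminates the shift.\<close>

lemma L2_set_le_of_unit_ball_subset:
  assumes sub: "(\<lambda>t. t - t0) ` unit_ball n \<subseteq> closed_convex_hull n (S \<union> uminus ` S)" and x: "x \<in> Rn n"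
    and le: "\<And>t. t \<in> S \<Longrightarrow> \<bar>\<Sum>i<n. t i * x i\<bar> \<le> \<beta>"
  shows "L2_set x {..<n} \<le> \<beta>"
proof -
  define r where "r = L2_set x {..<n}"
  have r0: "0 \<le> r" by (simp add: r_def)
  define y where "y = (\<lambda>i. x i / r)"
  have "L2_set y {..<n} = r / r"
    using L2_set_left_distrib[of "1 / r" x "{..<n}"] r0 by (simp add: y_def r_def)
  then have "L2_set y {..<n} \<le> 1" by simp
  moreover have "L2_set (- y) {..<n} = L2_set y {..<n}" by (simp add: L2_set_def)
  moreover have "y \<in> Rn n" using x by (simp add: y_def topspace_Euclidean_space)
  ultimately have y: "y \<in> unit_ball n" "- y \<in> unit_ball n"
    by (auto simp: unit_ball_def topspace_Euclidean_space)
  have yx: "(\<Sum>i<n. y i * x i) = r"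
  proof -
    have "(\<Sum>i<n. y i * x i) = (\<Sum>i<n. (x i)\<^sup>2) / r"
      by (simp add: y_def power2_eq_square sum_divide_distrib)
    also have "\<dots> = r\<^sup>2 / r" by (simp add: r_def L2_set_def sum_nonneg)
    finally show ?thesis by (simp add: power2_eq_square)
  qed
  have hull: "(\<Sum>i<n. (z - t0) i * w i) \<le> \<beta>"
    if "z \<in> unit_ball n" and w: "\<And>t. t \<in> S \<Longrightarrow> \<bar>\<Sum>i<n. t i * w i\<bar> \<le> \<beta>" for z w
  proof -
    let ?C = "{y :: nat \<Rightarrow> real. (\<Sum>i<n. y i * w i) \<le> \<beta>}"
    have "S \<union> uminus ` S \<subseteq> ?C"
      using w by (fastforce simp: sum_negf abs_le_iff)
    then have "closed_convex_hull n (S \<union> uminus ` S) \<subseteq> ?C"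
      by (intro closed_convex_hull_minimal closed_coordinate_halfspace convex_coordinate_halfspace)
    then show ?thesis using sub that(1) by blast
  qed
  have "(\<Sum>i<n. (y - t0) i * x i) \<le> \<beta>" using y le by (intro hull)
  moreover have "(\<Sum>i<n. (- y - t0) i * (- x) i) \<le> \<beta>"
    using y le by (intro hull) (auto simp: sum_negf)
  ultimately show ?thesis
    using yx by (simp add: left_diff_distrib right_diff_distrib sum_subtractf sum.distrib sum_negf r_def)
qed

text \<open>A level \<open>u\<close> whose value fell below the bound would yield a direction in
  which all points of \<open>S\<close> have small inner products, and then no translate of the ball
  fits into the hull. The shift \<open>t0\<close> is arbitrary, so the centred case and the final
  claim are both covered.\<close>

lemma M_val_ge:
  assumes sv: "stable_vector p n M X" and p: "1 < p" "p < 2" and n: "0 < n" "even n"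
    and sub: "(\<lambda>t. t - t0) ` unit_ball n \<subseteq> closed_convex_hull n (S \<union> uminus ` S)"
  shows "ennreal (4 / tail_scale p * net_scale p * real n powr (2 / p - 1 / 2)) \<le> M_val n M X S"
  unfolding M_val_def
proof (rule INF_greatest, rule ccontr)
  fix u :: real assume "u \<in> {0<..}"
  then have u: "0 < u" by simp
  let ?s = "ennreal u + (\<Sum>\<^sub>\<infinity>t\<in>S. \<integral>\<^sup>+\<omega>. ennreal (\<bar>lin_comb n X t \<omega>\<bar> *
        indicator {\<omega>. \<bar>lin_comb n X t \<omega>\<bar> \<ge> u} \<omega>) \<partial>M)"
  define Q where "Q = 4 / tail_scale p * net_scale p * real n powr (2 / p - 1 / 2)"
  have ts: "0 < tail_scale p" using tail_scale_ge[OF p] by simp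
  then have Q: "0 < Q" using n net_scale_pos[OF p(1)] by (simp add: Q_def)
  assume "\<not> ennreal (4 / tail_scale p * net_scale p * real n powr (2 / p - 1 / 2)) \<le> ?s"
  then have "?s \<le> ennreal Q" by (simp add: Q_def)
  from sum_L2_powr_le_of_tail_sum[OF sv p u this]
  have "\<And>G. finite G \<Longrightarrow> G \<subseteq> S \<Longrightarrow> (\<Sum>t\<in>G. L2_set t {..<n} powr p) \<le> (tail_scale p / 4 * Q) powr p"
    by blast
  then have "\<exists>x \<beta>. x \<in> Rn n \<and> \<beta> < L2_set x {..<n} \<and> (\<forall>t\<in>S. \<bar>\<Sum>i<n. t i * x i\<bar> \<le> \<beta>)"
    using Q ts
    by (intro exists_direction_with_small_marginals[OF p n, where R = "tail_scale p / 4 * Q"])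
      (use n net_scale_pos[OF p(1)] in \<open>auto simp: Q_def\<close>)
  then obtain x \<beta> where "x \<in> Rn n" "\<beta> < L2_set x {..<n}" "\<And>t. t \<in> S \<Longrightarrow> \<bar>\<Sum>i<n. t i * x i\<bar> \<le> \<beta>"
    by blast
  with L2_set_le_of_unit_ball_subset[OF sub, of x \<beta>] show False by fastforce
qed

section \<open>Uniform constants\<close>

text \<open>The minimum appears because one constant has to serve both the mean norm and
  \<open>M_val\<close>.\<close>

lemma stable_bounds_intrinsic:
  assumes p: "1 < p" "p < 2"
  shows "stable_bounds TYPE('a) p (min (1 / 20) (4 / tail_scale p * net_scale p)) (1 + 16 / (1 - 2 powr (1 - p)))"
    (is "stable_bounds _ p ?c ?C")
  unfolding stable_bounds_def b_val_unit_ball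
proof (intro allI impI conjI)
  fix n and M :: "'a measure" and X S
  assume H: "0 < n \<and> even n \<and> stable_vector p n M X"
  have "?c * real n powr (1 / p) \<le> 1 / 20 * real n powr (1 / p)"
    by (intro mult_right_mono) auto
  then show "?c * real n powr (1 / p) \<le> (\<integral>\<omega>. L2_set (\<lambda>i. X i \<omega>) {..<n} \<partial>M)"
    using norm_expectation_ge[of p n M X] H p by (meson order_trans)
  show "(\<integral>\<omega>. L2_set (\<lambda>i. X i \<omega>) {..<n} \<partial>M) \<le> ?C * real n powr (1 / p)"
    using norm_expectation_le[of p n M X] H p by blast
  assume S: "S \<noteq> {} \<and> countable S \<and> S \<subseteq> Rn n \<and> unit_ball n \<subseteq> closed_convex_hull n (S \<union> uminus ` S)"
  have "(\<lambda>t. t - (0 :: nat \<Rightarrow> real)) ` unit_ball n = unit_ball n" by simp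
  then have "ennreal (4 / tail_scale p * net_scale p * real n powr (2 / p - 1 / 2)) \<le> M_val n M X S"
    using H S p by (intro M_val_ge[where ?t0.0 = 0]) auto
  moreover have "?c * real n powr (2 / p - 1 / 2) \<le> 4 / tail_scale p * net_scale p * real n powr (2 / p - 1 / 2)"
    by (intro mult_right_mono) auto
  ultimately show "ennreal (?c * real n powr (2 / p - 1 / 2)) \<le> M_val n M X S"
    by (meson ennreal_leI order_trans)
qed (rule refl)

text \<open>These quantities depend only on the joint law of the coordinates, and that law lives on
  \<open>nat \<Rightarrow> real\<close> with the coordinate maps as random vector.\<close>

lemma stable_vector_push_forward:
  fixes M :: "'a measure"
  assumes sv: "stable_vector p n M X" and n: "0 < n"
  defines "M' \<equiv> distr M (\<Pi>\<^sub>M i\<in>{..<n}. borel) (\<lambda>\<omega>. \<lambda>i\<in>{..<n}. X i \<omega>)"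
  shows "stable_vector p n M' (\<lambda>i f. f i)"
    and "b_val n M' (\<lambda>i f. f i) (unit_ball n) = b_val n M X (unit_ball n)"
    and "(\<integral>f. L2_set (\<lambda>i. f i) {..<n} \<partial>M') = (\<integral>\<omega>. L2_set (\<lambda>i. X i \<omega>) {..<n} \<partial>M)"
    and "M_val n M' (\<lambda>i f. f i) S = M_val n M X S"
proof -
  interpret prob_space M using stable_vectorD[OF sv] by simp
  define P where "P = (\<Pi>\<^sub>M i\<in>{..<n}. (borel :: real measure))"
  define T where "T = (\<lambda>\<omega>. \<lambda>i\<in>{..<n}. X i \<omega>)"
  have M': "M' = distr M P T" by (simp add: M'_def P_def T_def)
  have T [measurable]: "T \<in> measurable M P"
    unfolding T_def P_def using stable_vectorD(3)[OF sv] by (intro measurable_restrict) auto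
  have coord [measurable]: "(\<lambda>f. f i) \<in> borel_measurable P" if "i < n" for i
    unfolding P_def using that by (intro measurable_component_singleton) auto
  have distr_coord: "distr M' borel (\<lambda>f. f i) = distr M borel (X i)" if "i < n" for i
  proof -
    have "distr M' borel (\<lambda>f. f i) = distr M borel ((\<lambda>f. f i) \<circ> T)"
      unfolding M' by (rule distr_distr[OF coord[OF that] T])
    also have "(\<lambda>f. f i) \<circ> T = X i" using that by (auto simp: T_def)
    finally show ?thesis .
  qed
  interpret M': prob_space M' unfolding M' by (rule prob_space_distr) simp
  \<comment> \<open>Independence is read as equality of the joint law with the product of the
    marginals; the map preserves both.\<close>
  have "M'.indep_vars (\<lambda>_. borel) (\<lambda>i f. f i) {..<n}"
  proof (subst M'.indep_vars_iff_distr_eq_PiM')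
    show ne: "{..<n} \<noteq> {}" using n by auto
    show "(\<lambda>f. f i) \<in> borel_measurable M'" if "i \<in> {..<n}" for i
      using coord[of i] that by (simp add: M')
    have "(\<lambda>f. \<lambda>i\<in>{..<n}. f i) \<in> measurable P P"
      unfolding P_def using coord[unfolded P_def] by (intro measurable_restrict) auto
    then have "distr M' P (\<lambda>f. \<lambda>i\<in>{..<n}. f i) = distr M P ((\<lambda>f. \<lambda>i\<in>{..<n}. f i) \<circ> T)"
      unfolding M' by (rule distr_distr) simp
    also have "(\<lambda>f. \<lambda>i\<in>{..<n}. f i) \<circ> T = T" by (auto simp: T_def)
    also have "distr M P T = (\<Pi>\<^sub>M i\<in>{..<n}. distr M borel (X i))"
      using stable_vectorD(2,3)[OF sv] indep_vars_iff_distr_eq_PiM'[OF ne, where M' = "\<lambda>_. borel" and X = X]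
      by (simp add: P_def T_def)
    also have "\<dots> = (\<Pi>\<^sub>M i\<in>{..<n}. distr M' borel (\<lambda>f. f i))"
      by (intro PiM_cong) (auto simp: distr_coord)
    finally show "distr M' (\<Pi>\<^sub>M i\<in>{..<n}. borel) (\<lambda>f. \<lambda>i\<in>{..<n}. f i) = (\<Pi>\<^sub>M i\<in>{..<n}. distr M' borel (\<lambda>f. f i))"
      by (simp only: P_def)
  qed
  then show "stable_vector p n M' (\<lambda>i f. f i)"
    using M'.prob_space_axioms stable_vectorD(4)[OF sv] by (simp add: stable_vector_def distr_coord)
  show L2: "(\<integral>f. L2_set (\<lambda>i. f i) {..<n} \<partial>M') = (\<integral>\<omega>. L2_set (\<lambda>i. X i \<omega>) {..<n} \<partial>M)"
    unfolding M'
  proof (subst integral_distr[OF T])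
    show "(\<lambda>f. L2_set (\<lambda>i. f i) {..<n}) \<in> borel_measurable P"
      unfolding L2_set_def by (intro measurable_compose[OF _ borel_measurable_sqrt]
        borel_measurable_sum borel_measurable_power coord) auto
  qed (auto simp: T_def intro!: Bochner_Integration.integral_cong L2_set_cong)
  then show "b_val n M' (\<lambda>i f. f i) (unit_ball n) = b_val n M X (unit_ball n)"
    by (simp add: b_val_unit_ball)
  have lc [measurable]: "lin_comb n (\<lambda>i f. f i) t \<in> borel_measurable P" for t
    unfolding lin_comb_def by (intro borel_measurable_sum borel_measurable_times coord) auto
  have lcT: "lin_comb n (\<lambda>i f. f i) t (T \<omega>) = lin_comb n X t \<omega>" for t \<omega>
    by (simp add: lin_comb_def T_def)
  have "(\<integral>\<^sup>+f. ennreal (\<bar>lin_comb n (\<lambda>i f. f i) t f\<bar> * indicator {f. \<bar>lin_comb n (\<lambda>i f. f i) t f\<bar> \<ge> u} f) \<partial>M')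
      = (\<integral>\<^sup>+\<omega>. ennreal (\<bar>lin_comb n X t \<omega>\<bar> * indicator {\<omega>. \<bar>lin_comb n X t \<omega>\<bar> \<ge> u} \<omega>) \<partial>M)" for t u
    unfolding M' by (subst nn_integral_distr[OF T]) (simp_all add: lcT indicator_def)
  then show "M_val n M' (\<lambda>i f. f i) S = M_val n M X S"
    by (simp add: M_val_def)
qed

text \<open>The constants are arbitrary here, so explicit values cannot be quoted; each random
  vector is replaced by its law on \<open>nat \<Rightarrow> real\<close>.\<close>

lemma stable_bounds_transfer:
  assumes "stable_bounds TYPE(nat \<Rightarrow> real) p c C"
  shows "stable_bounds TYPE('a) p c C"
  unfolding stable_bounds_def
proof (intro allI impI, elim conjE)
  fix n and M :: "'a measure" and X
  assume n: "0 < n" "even n" and sv: "stable_vector p n M X"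
  note pf = stable_vector_push_forward[OF sv n(1)]
  show "c * real n powr (1 / p) \<le> b_val n M X (unit_ball n) \<and>
        b_val n M X (unit_ball n) = (\<integral>\<omega>. L2_set (\<lambda>i. X i \<omega>) {..<n} \<partial>M) \<and>
        b_val n M X (unit_ball n) \<le> C * real n powr (1 / p) \<and>
        (\<forall>S. S \<noteq> {} \<and> countable S \<and> S \<subseteq> Rn n \<and>
             unit_ball n \<subseteq> closed_convex_hull n (S \<union> uminus ` S) \<longrightarrow>
             M_val n M X S \<ge> ennreal (c * real n powr (2 / p - 1 / 2)))"
    using assms n pf(1) unfolding stable_bounds_def pf(2-4)[symmetric] by blast
qed

theorem mainTheorem4:
  fixes p :: real
  assumes "1 < p" and "p < 2"
  shows
    "(\<exists>c C. 0 < c \<and> stable_bounds TYPE(nat \<Rightarrow> real) p c C) \<and>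
     (\<forall>c C. 0 < c \<and> stable_bounds TYPE(nat \<Rightarrow> real) p c C \<longrightarrow> stable_bounds TYPE('a) p c C) \<and>
     2 / p - 1 / 2 > 1 / p \<and>
     (\<forall>(M :: nat \<Rightarrow> 'a measure) (X :: nat \<Rightarrow> nat \<Rightarrow> 'a \<Rightarrow> real).
        (\<forall>n. 0 < n \<and> even n \<longrightarrow> stable_vector p n (M n) (X n)) \<longrightarrow>
        \<not> (\<exists>C::real. \<forall>n. 0 < n \<and> even n \<longrightarrow>
              (\<exists>t0 S. t0 \<in> Rn n \<and> S \<noteq> {} \<and> countable S \<and> S \<subseteq> Rn n \<and>
                 (\<lambda>t. t - t0) ` unit_ball n \<subseteq> closed_convex_hull n (S \<union> uminus ` S) \<and>
                 M_val n (M n) (X n) S \<le> ennreal (C * b_val n (M n) (X n) (unit_ball n)))))"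
proof (intro conjI allI impI notI)
  have "0 < tail_scale p" using tail_scale_ge[OF assms] by simp
  then have "0 < 4 / tail_scale p * net_scale p" using net_scale_pos[OF assms(1)] by simp
  then show "\<exists>c C. 0 < c \<and> stable_bounds TYPE(nat \<Rightarrow> real) p c C"
    using stable_bounds_intrinsic[OF assms, where 'a = "nat \<Rightarrow> real"]
    by (meson min_less_iff_conj zero_less_divide_1_iff zero_less_numeral)
  show "stable_bounds TYPE('a) p c C" if "0 < c \<and> stable_bounds TYPE(nat \<Rightarrow> real) p c C" for c C
    using that stable_bounds_transfer by blast
  show gap: "2 / p - 1 / 2 > 1 / p" using assms by (simp add: field_simps)
  fix M :: "nat \<Rightarrow> 'a measure" and X :: "nat \<Rightarrow> nat \<Rightarrow> 'a \<Rightarrow> real"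
  assume sv: "\<forall>n. 0 < n \<and> even n \<longrightarrow> stable_vector p n (M n) (X n)"
  assume "\<exists>C::real. \<forall>n. 0 < n \<and> even n \<longrightarrow>
      (\<exists>t0 S. t0 \<in> Rn n \<and> S \<noteq> {} \<and> countable S \<and> S \<subseteq> Rn n \<and>
         (\<lambda>t. t - t0) ` unit_ball n \<subseteq> closed_convex_hull n (S \<union> uminus ` S) \<and>
         M_val n (M n) (X n) S \<le> ennreal (C * b_val n (M n) (X n) (unit_ball n)))"
  then obtain C :: real where C: "\<And>n. 0 < n \<Longrightarrow> even n \<Longrightarrow>
      \<exists>t0 S. (\<lambda>t. t - t0) ` unit_ball n \<subseteq> closed_convex_hull n (S \<union> uminus ` S) \<and>
         M_val n (M n) (X n) S \<le> ennreal (C * b_val n (M n) (X n) (unit_ball n))"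
    by metis
  define c where "c = 4 / tail_scale p * net_scale p"
  define C' where "C' = 1 + 16 / (1 - 2 powr (1 - p))"
  \<comment> \<open>The gap between the growth exponents of \<open>M_val\<close> and of the mean
    norm.\<close>
  define e where "e = 2 / p - 1 / 2 - 1 / p"
  have c: "0 < c" unfolding c_def by fact
  have e: "0 < e" using gap by (simp add: e_def)
  have C'0: "0 \<le> C'"
    using assms by (auto simp: C'_def powr_less_one less_imp_le intro!: add_nonneg_nonneg divide_nonneg_nonneg)
  \<comment> \<open>The lower bound for \<open>M_val\<close> meets the supposed upper bound;
    dividing by \<open>n powr (1 / p)\<close> leaves a bound on \<open>n powr e\<close> that does
    not depend on \<open>n\<close>.\<close>
  have bound: "real n powr e \<le> \<bar>C\<bar> * C' / c" if n: "0 < n" "even n" for n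
  proof -
    obtain t0 S where S: "(\<lambda>t. t - t0) ` unit_ball n \<subseteq> closed_convex_hull n (S \<union> uminus ` S)"
      "M_val n (M n) (X n) S \<le> ennreal (C * b_val n (M n) (X n) (unit_ball n))"
      using C[OF n] by blast
    have svn: "stable_vector p n (M n) (X n)" using sv n by blast
    have b: "b_val n (M n) (X n) (unit_ball n) \<le> C' * real n powr (1 / p)" "0 \<le> b_val n (M n) (X n) (unit_ball n)"
      unfolding b_val_unit_ball C'_def using norm_expectation_le[OF svn assms n(1)] by auto
    have "ennreal (c * real n powr (2 / p - 1 / 2)) \<le> M_val n (M n) (X n) S"
      unfolding c_def by (rule M_val_ge[OF svn assms n S(1)])
    also note S(2)
    \<comment> \<open>The sign of \<open>C\<close> is unknown, hence the absolute value.\<close>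
    also have "ennreal (C * b_val n (M n) (X n) (unit_ball n)) \<le> ennreal (\<bar>C\<bar> * (C' * real n powr (1 / p)))"
      using b by (intro ennreal_leI mult_mono) auto
    finally have "c * real n powr (2 / p - 1 / 2) \<le> \<bar>C\<bar> * (C' * real n powr (1 / p))"
      using C'0 by simp
    moreover have "real n powr (2 / p - 1 / 2) = real n powr e * real n powr (1 / p)"
      by (simp add: e_def flip: powr_add)
    ultimately have "(c * real n powr e) * real n powr (1 / p) \<le> (\<bar>C\<bar> * C') * real n powr (1 / p)"
      by (simp add: mult.assoc)
    then have "c * real n powr e \<le> \<bar>C\<bar> * C'" using n by (simp add: mult_le_cancel_right)
    then show ?thesis using c by (simp add: field_simps)
  qed
  \<comment> \<open>One more than the supposed bound; the even dimension \<open>2 * k\<close> with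
    \<open>k powr e\<close> above \<open>K\<close> then gives the contradiction.\<close>
  define K where "K = \<bar>C\<bar> * C' / c + 1"
  have K: "0 < K" using c C'0 by (auto simp: K_def intro!: add_nonneg_pos divide_nonneg_pos)
  obtain k :: nat where k: "K powr (1 / e) < real k" using reals_Archimedean2 by blast
  then have "0 < k" using K by (metis of_nat_0_less_iff order_less_trans powr_gt_zero less_numeral_extra(3))
  have "K = (K powr (1 / e)) powr e" using K e by (simp add: powr_powr)
  also have "\<dots> \<le> real (2 * k) powr e" using k e by (intro powr_mono2) auto
  also have "\<dots> \<le> \<bar>C\<bar> * C' / c" using \<open>0 < k\<close> by (intro bound) auto
  finally show False by (simp add: K_def)
qed

end
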